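(* Let $(L,\leq,0_L,1_L)$ be a bounded lattice and let $e_1,a,e_2\in L$ with $0_L\leq e_1\leq a\leq e_2\leq 1_L$. For an injective increasing function $f:L\to[-\infty,+\infty]$ with $f(e_1)=0$, consider the following conditions, each required for all $x,y\in L$: (A1) if $(f(x),f(y))\in[0,f(a)]^2\cup[-\infty,0]^2$, then $\min\{f(x)+f(y),f(a)\}\in\mathrm{Ran}(f)\cup[-\infty,f(0_L))$; (A2) if $(f(x),f(y))\in[0,f(a)]^2\cup[-\infty,0]^2$ and $f(x),f(y)$ have at least one same summand $f(z)\in\mathrm{Ran}(f)$, then $x,y$ are comparable; (A3) if $f(x)<0<f(y)\leq f(a)$ and $x<e_1$, then $x,y$ are comparable; (A4) if $f(a)\leq f(x)<f(y)$ or $f(x)<0<f(a)\leq f(y)$, then $x,y$ are comparable; (A4$'$) if $f(a)\leq f(x)<f(y)$, then $x,y$ are comparable; (A5) if $f(x),f(y)\in(0,f(a))$, $f(x)+f(y)\in\mathrm{Ran}(f)$ and $0<f(x)+f(y)\leq f(a)$, then $f^{-1}(f(x)+f(y))$ and $a$ are comparable. For an injective decreasing function $f:L\to[-\infty,+\infty]$ with $f(e_1)=0$, consider the following conditions, each required for all $x,y\in L$: (D1) if $(f(x),f(y))\in[f(a),0]^2\cup[0,+\infty]^2$, then $\max\{f(x)+f(y),f(a)\}\in\mathrm{Ran}(f)\cup(f(0_L),+\infty]$; (D2) if $(f(x),f(y))\in[f(a),0]^2\cup[0,+\infty]^2$ and $f(x),f(y)$ have at least one same summand $f(z)\in\mathrm{Ran}(f)$,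 then $x,y$ are comparable; (D3) if $f(a)\leq f(x)<0<f(y)$ and $y<e_1$, then $x,y$ are comparable; (D4) if $f(a)\geq f(x)>f(y)$ or $f(x)\leq f(a)<0<f(y)$, then $x,y$ are comparable; (D4$'$) if $f(x)<f(y)\leq f(a)$, then $x,y$ are comparable; (D5) if $f(x),f(y)\in(f(a),0)$, $f(x)+f(y)\in\mathrm{Ran}(f)$ and $f(a)\leq f(x)+f(y)<0$, then $f^{-1}(f(x)+f(y))$ and $a$ are comparable. Then the following hold (each displayed operation being defined for all $x,y\in L$). (i) If $e_2=1_L$ and $f$ is injective increasing with $f(e_1)=0$ satisfying (A1)–(A5), then the following $U_N$ is a uni-nullnorm: $$U_N(x,y)=\begin{cases} f^{(-1)}(f(x)+f(y)), & (f(x),f(y))\in[-\infty,0]^2,\\ f^{(-1)}(\min\{f(x)+f(y),f(a)\}), & (f(x),f(y))\in[0,f(a)]^2 \text{ and } x,y\notin I_a,\\ a, & (f(x),f(y))\in[f(a),+\infty]\times[0,f(a)]\cup[0,f(a)]\times[f(a),+\infty]\\ &\quad\cup[0,f(a)]\times\mathcal{F}_a\cup\mathcal{F}_a\times[0,f(a)],\\ f^{(-1)}(\min\{f(x),f(y)\}), & \text{otherwise.}\end{cases}$$ (ii) If $e_2=1_L$ and $f$ is injective decreasing with $f(e_1)=0$ satisfying (D1)–(D5), then the following $U_N$ is a uni-nullnorm: $$U_N(x,y)=\begin{cases} f^{(-1)}(f(x)+f(y)), & (f(x),f(y))\in(0,+\infty]^2,\\ f^{(-1)}(\max\{f(x)+f(y),f(a)\}),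 & (f(x),f(y))\in[f(a),0]^2 \text{ and } x,y\notin I_a,\\ a, & (f(x),f(y))\in[-\infty,f(a))\times[f(a),0]\cup[f(a),0]\times[-\infty,f(a))\\ &\quad\cup[f(a),0]\times\mathcal{G}_a\cup\mathcal{G}_a\times[f(a),0],\\ f^{(-1)}(\max\{f(x),f(y)\}), & \text{otherwise.}\end{cases}$$ (iii) If $e_1=0_L$ and $f:L\to[0,+\infty]$ is injective increasing with $f(0_L)=0$ satisfying (A1), (A2), (A4$'$), (A5), then the following $N_U$ is a null-uninorm: $$N_U(x,y)=\begin{cases} f^{(-1)}(\min\{f(x)+f(y),f(a)\}), & (f(x),f(y))\in[0,f(a)]^2 \text{ and } x,y\notin I_a,\\ a, & (f(x),f(y))\in[f(a),+\infty]\times[0,f(a)]\cup[0,f(a)]\times[f(a),+\infty]\\ &\quad\cup[0,f(a)]\times\mathcal{F}_a\cup\mathcal{F}_a\times[0,f(a)],\\ f^{(-1)}(\min\{f(x),f(y)\}), & (f(x),f(y))\in[f(a),f(e_2)]^2,\\ f^{(-1)}(\max\{f(x),f(y)\}), & \text{otherwise.}\end{cases}$$ (iv) If $e_1=0_L$ and $f:L\to[-\infty,0]$ is injective decreasing with $f(0_L)=0$ satisfying (D1), (D2), (D4$'$), (D5), then the following $N_U$ is a null-uninorm: $$N_U(x,y)=\begin{cases} f^{(-1)}(\max\{f(x)+f(y),f(a)\}), & (f(x),f(y))\in[f(a),0]^2 \text{ and } x,y\notin I_a,\\ a, & (f(x),f(y))\in[-\infty,f(a))\times[f(a),0]\cup[f(a),0]\times[-\infty,f(a))\\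 &\quad\cup[f(a),0]\times\mathcal{G}_a\cup\mathcal{G}_a\times[f(a),0],\\ f^{(-1)}(\max\{f(x),f(y)\}), & (f(x),f(y))\in[f(e_2),f(a)]^2,\\ f^{(-1)}(\min\{f(x),f(y)\}), & \text{otherwise.}\end{cases}$$ (v) If $e_1=0_L$, $e_2=1_L$ and $f:L\to[0,+\infty]$ is injective increasing with $f(0_L)=0$ satisfying (A1), (A2), (A4$'$), (A5), then the following $N$ is a nullnorm: $$N(x,y)=\begin{cases} f^{(-1)}(\min\{f(x)+f(y),f(a)\}), & (f(x),f(y))\in[0,f(a)]^2 \text{ and } x,y\notin I_a,\\ a, & (f(x),f(y))\in[f(a),+\infty]\times[0,f(a)]\cup[0,f(a)]\times[f(a),+\infty]\\ &\quad\cup[0,f(a)]\times\mathcal{F}_a\cup\mathcal{F}_a\times[0,f(a)],\\ f^{(-1)}(\min\{f(x),f(y)\}), & \text{otherwise.}\end{cases}$$ (vi) If $e_1=0_L$, $e_2=1_L$ and $f:L\to[-\infty,0]$ is injective decreasing with $f(0_L)=0$ satisfying (D1), (D2), (D4$'$), (D5), then the following $N$ is a nullnorm: $$N(x,y)=\begin{cases} f^{(-1)}(\max\{f(x)+f(y),f(a)\}), & (f(x),f(y))\in[f(a),0]^2 \text{ and } x,y\notin I_a,\\ a, & (f(x),f(y))\in[-\infty,f(a))\times[f(a),0]\cup[f(a),0]\times[-\infty,f(a))\\ &\quad\cup[f(a),0]\times\mathcal{G}_a\cup\mathcal{G}_a\times[f(a),0],\\ f^{(-1)}(\max\{f(x),f(y)\}),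 & \text{otherwise.}\end{cases}$$ (vii) If $a=1_L$ and $f$ is injective increasing with $f(e_1)=0$ satisfying (A1), (A2), (A3), then the following $U$ is a uninorm: $$U(x,y)=\begin{cases} f^{(-1)}(f(x)+f(y)), & (f(x),f(y))\in[-\infty,0]^2\cup[0,+\infty]^2,\\ f^{(-1)}(\min\{f(x),f(y)\}), & \text{otherwise;}\end{cases}$$ moreover, taking $e_1=1_L$ and $e_1=0_L$ in this formula yields a t-norm and a t-conorm, respectively. (viii) If $a=1_L$ and $f$ is injective decreasing with $f(e_1)=0$ satisfying (D1), (D2), (D3), then the following $U$ is a uninorm: $$U(x,y)=\begin{cases} f^{(-1)}(f(x)+f(y)), & (f(x),f(y))\in[-\infty,0]^2\cup[0,+\infty]^2,\\ f^{(-1)}(\max\{f(x),f(y)\}), & \text{otherwise.}\end{cases}$$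
   Context: A bounded lattice $(L,\leq,0_L,1_L)$ is a lattice with bottom element $0_L$ and top element $1_L$. Elements $x,y\in L$ are comparable if $x\leq y$ or $y\leq x$, and incomparable (written $x\parallel y$) otherwise. For $a\in L$, $I_a=\{x\in L:x\parallel a\}$. $\mathrm{Ran}(f)$ is the range of $f$. A function $f$ is increasing (decreasing) if $x\leq y$ implies $f(x)\leq f(y)$ ($f(x)\geq f(y)$). For $f$ injective increasing, $\mathcal{F}_a=\{f(x):x\in I_a,\ 0<f(x)<f(a)\}$; for $f$ injective decreasing, $\mathcal{G}_a=\{f(x):x\in I_a,\ f(a)<f(x)<0\}$. Pseudo-inverse $f^{(-1)}:[-\infty,+\infty]\to L$ of an injective monotone non-constant $f:L\to[-\infty,+\infty]$ (when it exists): $f^{(-1)}(y)=f^{-1}(y)$ (the unique preimage) if $y\in\mathrm{Ran}(f)$; if $y\notin\mathrm{Ran}(f)$, then $f^{(-1)}(y)=\inf\{x\in L:f(x)>y\}$ when $f$ is increasing and $f^{(-1)}(y)=\sup\{x\in L:f(x)>y\}$ when $f$ is decreasing. Summand: let $0\in A\subseteq[-\infty,+\infty]$. For non-zero $x,s\in A$, $s$ is a summand of $x$ in $A$ if there is $b\in A$ with $x=s+b$ and $sb\geq0$. The element $0$ has no summands; every non-zero $x\in A$ is a summand of itself. Here summands are taken in $A=\mathrm{Ran}(f)$. All of the following are commutative, associative binary operations $L^2\to L$ that are increasing in both variables, with the additional property stated: - t-norm $T$: $T(x,1_L)=x$ for all $x\in L$. t-conorm $S$: $S(x,0_L)=x$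 for all $x\in L$. - uninorm: has a neutral element $e\in L$. - nullnorm $V$: there is $a\in L$ (zero element) with $V(x,0_L)=x$ for all $x\in[0_L,a]$ and $V(x,1_L)=x$ for all $x\in[a,1_L]$. - uni-nullnorm $F$: there are $e,a\in L$ with $0_L\leq e<a\leq1_L$ such that $F(e,x)=x$ for all $x\in[0_L,a]$ and $F(x,1_L)=x$ for all $x\in[a,1_L]$. - 2-uninorm $\mathbb{U}$ (for $0_L\leq e_1\leq a\leq e_2\leq1_L$): $\mathbb{U}(e_1,x)=x$ for all $x\leq a$ and $\mathbb{U}(e_2,x)=x$ for all $x\geq a$. - null-uninorm: a 2-uninorm with $e_1=0_L$.
   Formalization: In (i) and (ii) e_1 < a is assumed, since for e_1 = a the operation is never a uni-nullnorm; in (iii) and (iv) a < e_2 or a = 1_L is assumed, since for a = e_2 < 1_L one gets N_U(e_2,1_L) = a, so e_2 is not neutral above a. *)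

theory Defs
  imports "HOL-Library.Extended_Real" "HOL-Library.Lub_Glb"
begin

section \<open>Order-theoretic and arithmetical preliminaries\<close>

definition comparable :: "'a::order \<Rightarrow> 'a \<Rightarrow> bool" where
  "comparable x y \<longleftrightarrow> x \<le> y \<or> y \<le> x"

definition incomp :: "'a::order \<Rightarrow> 'a set" where
  "incomp a = {x. \<not> comparable x a}"

definition F_set :: "('a::order \<Rightarrow> ereal) \<Rightarrow> 'a \<Rightarrow> ereal set" where
  "F_set f a = {f x |x. x \<in> incomp a \<and> 0 < f x \<and> f x < f a}"

definition G_set :: "('a::order \<Rightarrow> ereal) \<Rightarrow> 'a \<Rightarrow> ereal set" where
  "G_set f a = {f x |x. x \<in> incomp a \<and> f a < f x \<and> f x < 0}"

text \<open>
  In \<^typ>\<open>ereal\<close> the sum of \<open>\<infinity>\<close> and \<open>-\<infinity>\<close> is set to \<open>\<infinity>\<close>. This convention never matters below: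
  the sign condition \<open>s * b \<ge> 0\<close> excludes such sums here, and all other sums that
  occur have summands of the same (weak) sign.
\<close>

definition summand :: "ereal set \<Rightarrow> ereal \<Rightarrow> ereal \<Rightarrow> bool" where
  "summand A s x \<longleftrightarrow>
     s \<in> A \<and> x \<in> A \<and> s \<noteq> 0 \<and> x \<noteq> 0 \<and> (\<exists>b\<in>A. x = s + b \<and> s * b \<ge> 0)"

definition common_summand :: "('a \<Rightarrow> ereal) \<Rightarrow> 'a \<Rightarrow> 'a \<Rightarrow> bool" where
  "common_summand f x y \<longleftrightarrow>
     (\<exists>z. summand (range f) (f z) (f x) \<and> summand (range f) (f z) (f y))"

text \<open>
  The lattice need not be complete, so the infimum or supremum defining the pseudo-inverse
  outside the range of \<open>f\<close> may fail to exist; the value is then \<^const>\<open>None\<close>.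
  The definition is meant for injective monotone \<open>f\<close>.
\<close>

definition is_pinv :: "('a::order \<Rightarrow> ereal) \<Rightarrow> ereal \<Rightarrow> 'a \<Rightarrow> bool" where
  "is_pinv f y z \<longleftrightarrow>
     (if y \<in> range f then f z = y
      else if mono f then isGlb UNIV {x. f x > y} z
      else isLub UNIV {x. f x > y} z)"

definition pinv :: "('a::order \<Rightarrow> ereal) \<Rightarrow> ereal \<Rightarrow> 'a option" where
  "pinv f y = (if \<exists>z. is_pinv f y z then Some (THE z. is_pinv f y z) else None)"


section \<open>Classes of aggregation operations\<close>

definition aggregation :: "('a::bounded_lattice \<Rightarrow> 'a \<Rightarrow> 'a) \<Rightarrow> bool" where
  "aggregation F \<longleftrightarrow>
     abel_semigroup F \<and> (\<forall>x. mono (F x)) \<and> (\<forall>y. mono (\<lambda>x. F x y))"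

definition t_norm :: "('a::bounded_lattice \<Rightarrow> 'a \<Rightarrow> 'a) \<Rightarrow> bool" where
  "t_norm T \<longleftrightarrow> aggregation T \<and> (\<forall>x. T x top = x)"

definition t_conorm :: "('a::bounded_lattice \<Rightarrow> 'a \<Rightarrow> 'a) \<Rightarrow> bool" where
  "t_conorm S \<longleftrightarrow> aggregation S \<and> (\<forall>x. S x bot = x)"

definition uninorm :: "('a::bounded_lattice \<Rightarrow> 'a \<Rightarrow> 'a) \<Rightarrow> bool" where
  "uninorm U \<longleftrightarrow> aggregation U \<and> (\<exists>e. \<forall>x. U e x = x)"

definition nullnorm :: "('a::bounded_lattice \<Rightarrow> 'a \<Rightarrow> 'a) \<Rightarrow> bool" where
  "nullnorm V \<longleftrightarrow> aggregation V \<and>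
     (\<exists>a. (\<forall>x\<in>{bot..a}. V x bot = x) \<and> (\<forall>x\<in>{a..top}. V x top = x))"

definition uni_nullnorm :: "('a::bounded_lattice \<Rightarrow> 'a \<Rightarrow> 'a) \<Rightarrow> bool" where
  "uni_nullnorm F \<longleftrightarrow> aggregation F \<and>
     (\<exists>e a. e < a \<and> (\<forall>x\<in>{bot..a}. F e x = x) \<and> (\<forall>x\<in>{a..top}. F x top = x))"

definition two_uninorm ::
  "'a::bounded_lattice \<Rightarrow> 'a \<Rightarrow> 'a \<Rightarrow> ('a \<Rightarrow> 'a \<Rightarrow> 'a) \<Rightarrow> bool" where
  "two_uninorm e1 a e2 U \<longleftrightarrow> e1 \<le> a \<and> a \<le> e2 \<and> aggregation U \<and>
     (\<forall>x. x \<le> a \<longrightarrow> U e1 x = x) \<and> (\<forall>x. x \<ge> a \<longrightarrow> U e2 x = x)"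

definition null_uninorm ::
  "'a::bounded_lattice \<Rightarrow> 'a \<Rightarrow> ('a \<Rightarrow> 'a \<Rightarrow> 'a) \<Rightarrow> bool" where
  "null_uninorm a e2 U \<longleftrightarrow> two_uninorm bot a e2 U"


section \<open>Conditions on increasing generators\<close>

definition region_inc :: "('a \<Rightarrow> ereal) \<Rightarrow> 'a \<Rightarrow> (ereal \<times> ereal) set" where
  "region_inc f a = {0..f a} \<times> {0..f a} \<union> {-\<infinity>..0} \<times> {-\<infinity>..0}"

definition A1 :: "('a::bounded_lattice \<Rightarrow> ereal) \<Rightarrow> 'a \<Rightarrow> bool" where
  "A1 f a \<longleftrightarrow> (\<forall>x y. (f x, f y) \<in> region_inc f a \<longrightarrow>
     min (f x + f y) (f a) \<in> range f \<union> {-\<infinity>..<f bot})"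

definition A2 :: "('a::bounded_lattice \<Rightarrow> ereal) \<Rightarrow> 'a \<Rightarrow> bool" where
  "A2 f a \<longleftrightarrow> (\<forall>x y. (f x, f y) \<in> region_inc f a \<and> common_summand f x y \<longrightarrow> comparable x y)"

definition A3 :: "('a::bounded_lattice \<Rightarrow> ereal) \<Rightarrow> 'a \<Rightarrow> 'a \<Rightarrow> bool" where
  "A3 f e1 a \<longleftrightarrow> (\<forall>x y. f x < 0 \<and> 0 < f y \<and> f y \<le> f a \<and> x < e1 \<longrightarrow> comparable x y)"

definition A4 :: "('a::bounded_lattice \<Rightarrow> ereal) \<Rightarrow> 'a \<Rightarrow> bool" where
  "A4 f a \<longleftrightarrow> (\<forall>x y. (f a \<le> f x \<and> f x < f y) \<or> (f x < 0 \<and> 0 < f a \<and> f a \<le> f y)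
     \<longrightarrow> comparable x y)"

definition A4' :: "('a::bounded_lattice \<Rightarrow> ereal) \<Rightarrow> 'a \<Rightarrow> bool" where
  "A4' f a \<longleftrightarrow> (\<forall>x y. f a \<le> f x \<and> f x < f y \<longrightarrow> comparable x y)"

definition A5 :: "('a::bounded_lattice \<Rightarrow> ereal) \<Rightarrow> 'a \<Rightarrow> bool" where
  "A5 f a \<longleftrightarrow> (\<forall>x y. f x \<in> {0<..<f a} \<and> f y \<in> {0<..<f a} \<and> f x + f y \<in> range f \<and>
     0 < f x + f y \<and> f x + f y \<le> f a \<longrightarrow> comparable (inv f (f x + f y)) a)"


section \<open>Conditions on decreasing generators\<close>

definition region_dec :: "('a \<Rightarrow> ereal) \<Rightarrow> 'a \<Rightarrow> (ereal \<times> ereal) set" where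
  "region_dec f a = {f a..0} \<times> {f a..0} \<union> {0..\<infinity>} \<times> {0..\<infinity>}"

definition D1 :: "('a::bounded_lattice \<Rightarrow> ereal) \<Rightarrow> 'a \<Rightarrow> bool" where
  "D1 f a \<longleftrightarrow> (\<forall>x y. (f x, f y) \<in> region_dec f a \<longrightarrow>
     max (f x + f y) (f a) \<in> range f \<union> {f bot<..\<infinity>})"

definition D2 :: "('a::bounded_lattice \<Rightarrow> ereal) \<Rightarrow> 'a \<Rightarrow> bool" where
  "D2 f a \<longleftrightarrow> (\<forall>x y. (f x, f y) \<in> region_dec f a \<and> common_summand f x y \<longrightarrow> comparable x y)"

definition D3 :: "('a::bounded_lattice \<Rightarrow> ereal) \<Rightarrow> 'a \<Rightarrow> 'a \<Rightarrow> bool" where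
  "D3 f e1 a \<longleftrightarrow> (\<forall>x y. f a \<le> f x \<and> f x < 0 \<and> 0 < f y \<and> y < e1 \<longrightarrow> comparable x y)"

definition D4 :: "('a::bounded_lattice \<Rightarrow> ereal) \<Rightarrow> 'a \<Rightarrow> bool" where
  "D4 f a \<longleftrightarrow> (\<forall>x y. (f a \<ge> f x \<and> f x > f y) \<or> (f x \<le> f a \<and> f a < 0 \<and> 0 < f y)
     \<longrightarrow> comparable x y)"

definition D4' :: "('a::bounded_lattice \<Rightarrow> ereal) \<Rightarrow> 'a \<Rightarrow> bool" where
  "D4' f a \<longleftrightarrow> (\<forall>x y. f x < f y \<and> f y \<le> f a \<longrightarrow> comparable x y)"

definition D5 :: "('a::bounded_lattice \<Rightarrow> ereal) \<Rightarrow> 'a \<Rightarrow> bool" where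
  "D5 f a \<longleftrightarrow> (\<forall>x y. f x \<in> {f a<..<0} \<and> f y \<in> {f a<..<0} \<and> f x + f y \<in> range f \<and>
     f a \<le> f x + f y \<and> f x + f y < 0 \<longrightarrow> comparable (inv f (f x + f y)) a)"


section \<open>The generated operations\<close>

text \<open>
  Each operation is partial, being built from \<^const>\<open>pinv\<close>. The cases of the mathematical
  definitions may overlap (at pairs of values one of which is \<open>0\<close> or \<open>f a\<close>); for the generators considered
  the formulas agree there, so the order of the conditionals is immaterial.
\<close>

definition zero_region_inc :: "('a::order \<Rightarrow> ereal) \<Rightarrow> 'a \<Rightarrow> (ereal \<times> ereal) set" where
  "zero_region_inc f a =
     {f a..\<infinity>} \<times> {0..f a} \<union> {0..f a} \<times> {f a..\<infinity>} \<union>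
     {0..f a} \<times> F_set f a \<union> F_set f a \<times> {0..f a}"

definition zero_region_dec :: "('a::order \<Rightarrow> ereal) \<Rightarrow> 'a \<Rightarrow> (ereal \<times> ereal) set" where
  "zero_region_dec f a =
     {-\<infinity>..<f a} \<times> {f a..0} \<union> {f a..0} \<times> {-\<infinity>..<f a} \<union>
     {f a..0} \<times> G_set f a \<union> G_set f a \<times> {f a..0}"

definition uni_null_inc :: "('a::order \<Rightarrow> ereal) \<Rightarrow> 'a \<Rightarrow> 'a \<Rightarrow> 'a \<Rightarrow> 'a option" where
  "uni_null_inc f a x y =
     (if (f x, f y) \<in> {-\<infinity>..0} \<times> {-\<infinity>..0} then pinv f (f x + f y)
      else if (f x, f y) \<in> {0..f a} \<times> {0..f a} \<and> x \<notin> incomp a \<and> y \<notin> incomp a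
        then pinv f (min (f x + f y) (f a))
      else if (f x, f y) \<in> zero_region_inc f a then Some a
      else pinv f (min (f x) (f y)))"

definition uni_null_dec :: "('a::order \<Rightarrow> ereal) \<Rightarrow> 'a \<Rightarrow> 'a \<Rightarrow> 'a \<Rightarrow> 'a option" where
  "uni_null_dec f a x y =
     (if (f x, f y) \<in> {0<..\<infinity>} \<times> {0<..\<infinity>} then pinv f (f x + f y)
      else if (f x, f y) \<in> {f a..0} \<times> {f a..0} \<and> x \<notin> incomp a \<and> y \<notin> incomp a
        then pinv f (max (f x + f y) (f a))
      else if (f x, f y) \<in> zero_region_dec f a then Some a
      else pinv f (max (f x) (f y)))"

definition null_uni_inc :: "('a::order \<Rightarrow> ereal) \<Rightarrow> 'a \<Rightarrow> 'a \<Rightarrow> 'a \<Rightarrow> 'a \<Rightarrow> 'a option" where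
  "null_uni_inc f a e2 x y =
     (if (f x, f y) \<in> {0..f a} \<times> {0..f a} \<and> x \<notin> incomp a \<and> y \<notin> incomp a
        then pinv f (min (f x + f y) (f a))
      else if (f x, f y) \<in> zero_region_inc f a then Some a
      else if (f x, f y) \<in> {f a..f e2} \<times> {f a..f e2} then pinv f (min (f x) (f y))
      else pinv f (max (f x) (f y)))"

definition null_uni_dec :: "('a::order \<Rightarrow> ereal) \<Rightarrow> 'a \<Rightarrow> 'a \<Rightarrow> 'a \<Rightarrow> 'a \<Rightarrow> 'a option" where
  "null_uni_dec f a e2 x y =
     (if (f x, f y) \<in> {f a..0} \<times> {f a..0} \<and> x \<notin> incomp a \<and> y \<notin> incomp a
        then pinv f (max (f x + f y) (f a))
      else if (f x, f y) \<in> zero_region_dec f a then Some a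
      else if (f x, f y) \<in> {f e2..f a} \<times> {f e2..f a} then pinv f (max (f x) (f y))
      else pinv f (min (f x) (f y)))"

definition null_inc :: "('a::order \<Rightarrow> ereal) \<Rightarrow> 'a \<Rightarrow> 'a \<Rightarrow> 'a \<Rightarrow> 'a option" where
  "null_inc f a x y =
     (if (f x, f y) \<in> {0..f a} \<times> {0..f a} \<and> x \<notin> incomp a \<and> y \<notin> incomp a
        then pinv f (min (f x + f y) (f a))
      else if (f x, f y) \<in> zero_region_inc f a then Some a
      else pinv f (min (f x) (f y)))"

definition null_dec :: "('a::order \<Rightarrow> ereal) \<Rightarrow> 'a \<Rightarrow> 'a \<Rightarrow> 'a \<Rightarrow> 'a option" where
  "null_dec f a x y =
     (if (f x, f y) \<in> {f a..0} \<times> {f a..0} \<and> x \<notin> incomp a \<and> y \<notin> incomp a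
        then pinv f (max (f x + f y) (f a))
      else if (f x, f y) \<in> zero_region_dec f a then Some a
      else pinv f (max (f x) (f y)))"

definition uni_inc :: "('a::order \<Rightarrow> ereal) \<Rightarrow> 'a \<Rightarrow> 'a \<Rightarrow> 'a option" where
  "uni_inc f x y =
     (if (f x, f y) \<in> {-\<infinity>..0} \<times> {-\<infinity>..0} \<union> {0..\<infinity>} \<times> {0..\<infinity>} then pinv f (f x + f y)
      else pinv f (min (f x) (f y)))"

definition uni_dec :: "('a::order \<Rightarrow> ereal) \<Rightarrow> 'a \<Rightarrow> 'a \<Rightarrow> 'a option" where
  "uni_dec f x y =
     (if (f x, f y) \<in> {-\<infinity>..0} \<times> {-\<infinity>..0} \<union> {0..\<infinity>} \<times> {0..\<infinity>} then pinv f (f x + f y)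
      else pinv f (max (f x) (f y)))"

definition total_op :: "('a \<Rightarrow> 'a \<Rightarrow> 'a option) \<Rightarrow> ('a \<Rightarrow> 'a \<Rightarrow> 'a) \<Rightarrow> bool" where
  "total_op G F \<longleftrightarrow> (\<forall>x y. G x y = Some (F x y))"

text \<open>
  Two degenerate parameter choices have to be excluded below. If \<open>e1 = a\<close>, then
  \<^const>\<open>uni_null_inc\<close> and \<^const>\<open>uni_null_dec\<close> are never uni-nullnorms, whose definition
  asks for \<open>e < a\<close>. If \<open>a = e2 < top\<close>, then \<^const>\<open>null_uni_inc\<close> and \<^const>\<open>null_uni_dec\<close> send
  \<open>(e2, top)\<close> to \<open>a\<close>, so that \<open>e2\<close> is not neutral above \<open>a\<close>.
\<close>

end

theory Submission
  imports Defs
begin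

text \<open>
  Transported along an increasing generator \<open>g\<close>, every operation of the theorem is an ordinal-sum
  like gluing: truncated addition on the negative values, truncated addition on the
  elements below \<open>a\<close> with non-negative value, an idempotent minimum-maximum operation on the chain above \<open>a\<close>, the minimum between
  negative and non-negative values, and the constant \<open>a\<close> elsewhere. Associativity is therefore a
  matter of values. Monotonicity is not, because \<open>g\<close> does not reflect the order; there
  the conditions on common summands make exactly those elements comparable whose values have to
  be compared.

  A single such operation, with neutral elements \<open>e1\<close> below \<open>a\<close> and \<open>e2\<close> above \<open>a\<close>, covers all the
  cases: \<open>e2 = top\<close> gives uni-nullnorms, \<open>e1 = bot\<close> null-uninorms, both together nullnorms, and
  \<open>a = top\<close> uninorms. A decreasing generator \<open>f\<close> is replaced by \<open>- f\<close>; the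
  pseudo-inverses of \<open>f\<close> and \<open>- f\<close> correspond on the range and beyond the values at \<open>bot\<close> and
  \<open>top\<close>, and no other arguments occur.
\<close>

section \<open>Truncated addition of extended reals\<close>

text \<open>The sign hypothesis excludes adding opposite infinities, where the sum is set to
  \<infinity> and negation would not distribute over it.\<close>

lemma ereal_uminus_add_same_sign:
  fixes u v :: ereal
  assumes "0 \<le> u \<and> 0 \<le> v \<or> u \<le> 0 \<and> v \<le> 0"
  shows "- u + - v = - (u + v)"
  using assms by (cases u; cases v) auto

lemma ereal_min_uminus: "- min u v = max (- u) (- v)" for u v :: ereal
  by (auto simp: min_def max_def)

lemma ereal_max_uminus: "- max u v = min (- u) (- v)" for u v :: ereal
  by (auto simp: min_def max_def)

text \<open>An inner truncation at \<open>c\<close> is absorbed by the outer one: once a partial sum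
  has reached \<open>c\<close>, a non-negative summand cannot bring it below \<open>c\<close>
  again.\<close>

lemma ereal_truncated_add_assoc_le:
  fixes u v w c :: ereal
  assumes "0 \<le> u" "0 \<le> v" "0 \<le> w"
  shows "min (min (u + v) c + w) c = min (u + min (v + w) c) c"
proof -
  have 1: "min (min s c + t) c = min (s + t) c" if "0 \<le> t" for s t
  proof (cases "s \<le> c")
    case False
    then have "c \<le> s + t" "c \<le> c + t"
      using that by (auto intro: add_increasing2)
    with False show ?thesis by (simp add: min_absorb2)
  qed (simp add: min_absorb1)
  show ?thesis
    using 1[OF assms(3), of "u + v"] 1[OF assms(1), of "v + w"] by (simp add: ac_simps)
qed

lemma ereal_truncated_add_assoc_ge:
  fixes u v w c :: ereal
  assumes "u \<le> 0" "v \<le> 0" "w \<le> 0"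
  shows "max (max (u + v) c + w) c = max (u + max (v + w) c) c"
proof -
  have 1: "max (max s c + t) c = max (s + t) c" if "t \<le> 0" for s t
  proof (cases "c \<le> s")
    case False
    then have "s + t \<le> c" "c + t \<le> c"
      using that by (auto intro: add_decreasing2)
    with False show ?thesis by (simp add: max_absorb2)
  qed (simp add: max_absorb1)
  show ?thesis
    using 1[OF assms(3), of "u + v"] 1[OF assms(1), of "v + w"] by (simp add: ac_simps)
qed

section \<open>Pseudo-inverses\<close>

lemma pinv_f_f:
  assumes "inj f"
  shows "pinv f (f z) = Some z"
proof -
  have "is_pinv f (f z) w \<longleftrightarrow> w = z" for w
    using assms by (auto simp: is_pinv_def inj_eq)
  then show ?thesis by (auto simp: pinv_def)
qed

lemma pinv_eqI:
  assumes "v \<notin> range f" "is_pinv f v z"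
  shows "pinv f v = Some z"
proof -
  have "w = z" if "is_pinv f v w" for w
    using assms that
    by (auto simp: is_pinv_def isGlb_def greatestP_def isLub_def leastP_def setge_def setle_def
        intro: order_antisym split: if_splits)
  with assms(2) have "(THE w. is_pinv f v w) = z" by (rule the_equality)
  then show ?thesis
    using assms(2) unfolding pinv_def by auto
qed

text \<open>Below all values of \<open>f\<close> the infimum runs over the whole lattice, and above
  all values over the empty set; both exist without completeness.\<close>

lemma pinv_below_mono:
  fixes f :: "'a::bounded_lattice \<Rightarrow> ereal"
  assumes "mono f" "v < f bot"
  shows "pinv f v = Some bot"
proof -
  have "v < f x" for x
    using assms monoD[OF assms(1), of bot x] by (simp add: less_le_trans)
  then have "v < f x" "v \<noteq> f x" for x
    by (auto simp: less_le)
  then show ?thesis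
    using assms(1)
    by (intro pinv_eqI) (auto simp: is_pinv_def isGlb_def greatestP_def isLb_def setge_def setle_def)
qed

lemma pinv_above_mono:
  fixes f :: "'a::bounded_lattice \<Rightarrow> ereal"
  assumes "mono f" "f top < v"
  shows "pinv f v = Some top"
proof -
  have "f x < v" for x
    using assms monoD[OF assms(1), of x top] by (simp add: le_less_trans)
  then have "\<not> v < f x" "v \<noteq> f x" for x
    by (auto simp: less_le_not_le)
  then show ?thesis
    using assms(1)
    by (intro pinv_eqI) (auto simp: is_pinv_def isGlb_def greatestP_def isLb_def setge_def setle_def)
qed

lemma pinv_above_antimono:
  fixes f :: "'a::bounded_lattice \<Rightarrow> ereal"
  assumes "inj f" "antimono f" "f bot < v"
  shows "pinv f v = Some bot"
proof (cases "mono f")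
  \<comment> \<open>\<open>is_pinv\<close> chooses its branch by \<open>mono f\<close>, so an
    antitone \<open>f\<close> may land in the infimum branch. By injectivity this happens only on a
    one-point lattice, where \<open>bot = top\<close>.\<close>
  case True
  have "f top = f bot"
    using monoD[OF True, of bot top] antimonoD[OF assms(2), of bot top] by simp
  then show ?thesis
    using pinv_above_mono[OF True, of v] assms(1,3) by (simp add: inj_eq)
next
  case False
  have "f x < v" for x
    using assms antimonoD[OF assms(2), of bot x] by (simp add: le_less_trans)
  then have "\<not> v < f x" "v \<noteq> f x" for x
    by (auto simp: less_le_not_le)
  then show ?thesis
    using False
    by (intro pinv_eqI) (auto simp: is_pinv_def isLub_def leastP_def isUb_def setge_def setle_def)
qed

lemma pinv_below_antimono:
  fixes f :: "'a::bounded_lattice \<Rightarrow> ereal"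
  assumes "inj f" "antimono f" "v < f top"
  shows "pinv f v = Some top"
proof (cases "mono f")
  case True
  have "f top = f bot"
    using monoD[OF True, of bot top] antimonoD[OF assms(2), of bot top] by simp
  then show ?thesis
    using pinv_below_mono[OF True, of v] assms(1,3) by (simp add: inj_eq)
next
  case False
  have "v < f x" for x
    using assms antimonoD[OF assms(2), of x top] by (simp add: less_le_trans)
  then have "v < f x" "v \<noteq> f x" for x
    by (auto simp: less_le)
  then show ?thesis
    using False
    by (intro pinv_eqI) (auto simp: is_pinv_def isLub_def leastP_def isUb_def setge_def setle_def)
qed

section \<open>The 2-uninorm of an increasing generator\<close>

text \<open>\<open>neg_le\<close> abstracts the second alternative of \<open>A4\<close>, so that the
  locale also covers the cases stated without \<open>A4\<close>. The assumption \<open>a_e2\<close>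
  excludes \<open>a = e2 < top\<close>.\<close>

locale generator =
  fixes g :: "'a::bounded_lattice \<Rightarrow> ereal" and e1 a e2 :: 'a
  assumes e1_le_a: "e1 \<le> a" and a_le_e2: "a \<le> e2" and a_e2: "a < e2 \<or> a = top"
    and inj_g: "inj g" and mono_g: "mono g" and g_e1: "g e1 = 0"
    and A1: "A1 g a" and A2: "A2 g a" and A3: "A3 g e1 a" and A4': "A4' g a"
    and neg_le: "\<And>x y. g x < 0 \<Longrightarrow> g a \<le> g y \<Longrightarrow> x \<le> y"
    and A5: "A5 g a"
begin

text \<open>This has the shape of an idempotent uninorm on the chain of values above
  \<open>g a\<close>: minimum up to \<open>g e2\<close>, maximum once an argument exceeds
  \<open>g e2\<close>. Hence \<open>g e2\<close> is neutral.\<close>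

definition upper :: "ereal \<Rightarrow> ereal \<Rightarrow> ereal" where
  "upper s t = (if s \<le> g e2 \<and> t \<le> g e2 then min s t else max s t)"

text \<open>The strict sign tests give negative elements precedence. Truncation at
  \<open>g bot\<close> replaces the pseudo-inverse below all values, and for mixed signs the
  argument of smaller value is returned directly, so \<open>inv g\<close> is applied only to values
  that turn out to lie in the range.\<close>

definition op :: "'a \<Rightarrow> 'a \<Rightarrow> 'a" where
  "op x y =
     (if g x < 0 \<and> g y < 0 then inv g (max (g x + g y) (g bot))
      else if g x < 0 then x
      else if g y < 0 then y
      else if x \<le> a \<and> y \<le> a then inv g (min (g x + g y) (g a))
      else if a < x \<and> a < y then inv g (upper (g x) (g y))
      else a)"

section \<open>Order of elements against values of \<open>g\<close>\<close>

lemma g_le: "x \<le> y \<Longrightarrow> g x \<le> g y"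
  using mono_g by (rule monoD)

lemma g_eq: "g x = g y \<longleftrightarrow> x = y"
  using inj_g by (simp add: inj_eq)

lemma g_less: "x < y \<Longrightarrow> g x < g y"
  by (metis g_le g_eq less_le)

lemma le_if_comparable: "comparable x y \<Longrightarrow> g x \<le> g y \<Longrightarrow> x \<le> y"
  unfolding comparable_def by (metis g_le g_eq order_antisym)

lemma g_bot_le: "g bot \<le> g x" and g_le_top: "g x \<le> g top"
  by (simp_all add: g_le)

lemma g_a_nonneg: "0 \<le> g a" and g_bot_nonpos: "g bot \<le> 0"
  using g_le[OF e1_le_a] g_bot_le[of e1] by (simp_all add: g_e1)

lemma inv_g: "inv g (g x) = x"
  using inj_g by simp

text \<open>\<open>A4'\<close> applied to \<open>a\<close> itself makes every element of larger
  value comparable with \<open>a\<close>.\<close>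

lemma above_a_iff: "a < x \<longleftrightarrow> g a < g x"
proof
  assume "g a < g x"
  with A4' have "comparable a x" unfolding A4'_def by blast
  with \<open>g a < g x\<close> show "a < x"
    using le_if_comparable by (auto simp: less_le)
qed (rule g_less)

lemma le_above_a:
  assumes "a \<le> x" "a \<le> y" "g x \<le> g y"
  shows "x \<le> y"
proof (cases "g x = g y")
  case False
  with assms A4' have "comparable x y"
    unfolding A4'_def by (meson g_le le_neq_trans)
  with assms show ?thesis using le_if_comparable by blast
qed (use g_eq in auto)

text \<open>A negative value would force \<open>x \<le> a\<close> by \<open>neg_le\<close>, the
  value 0 belongs to \<open>e1\<close> alone, and values exceeding \<open>g a\<close> lie above
  \<open>a\<close>. So the bounds written into \<open>F_set\<close> and \<open>G_set\<close> hold
  automatically.\<close>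

lemma incomp_bounds:
  assumes "x \<in> incomp a"
  shows "0 < g x" "g x < g a"
proof -
  have nc: "\<not> x \<le> a" "\<not> a \<le> x"
    using assms by (auto simp: incomp_def comparable_def)
  show "g x < g a"
    using nc above_a_iff[of x] g_eq[of x a] by fastforce
  have "x \<noteq> e1" using nc e1_le_a by auto
  then have "g x \<noteq> 0" using g_eq[of x e1] by (simp add: g_e1)
  moreover have "\<not> g x < 0" using neg_le[of x a] nc by auto
  ultimately show "0 < g x" by auto
qed

lemma le_a_iff: "x \<le> a \<longleftrightarrow> g x \<le> g a \<and> x \<notin> incomp a"
  using above_a_iff[of x] g_le[of x a] by (auto simp: incomp_def comparable_def g_eq less_le)

lemma neg_le_a: "g x < 0 \<Longrightarrow> x \<le> a"
  by (simp add: neg_le)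

section \<open>Values of the glued operation\<close>

lemma op_commute: "op x y = op y x"
  by (auto simp: op_def upper_def ac_simps)

text \<open>\<open>A1\<close> leaves the sum either in the range or below \<open>g bot\<close>;
  truncation takes care of the latter.\<close>

lemma op_neg_neg:
  assumes "g x < 0" "g y < 0"
  shows "g (op x y) = max (g x + g y) (g bot)"
proof -
  have "(g x, g y) \<in> region_inc g a" using assms by (auto simp: region_inc_def)
  then have "min (g x + g y) (g a) \<in> range g \<union> {-\<infinity>..<g bot}"
    using A1 unfolding A1_def by blast
  moreover have "min (g x + g y) (g a) = g x + g y"
    using assms g_a_nonneg by (meson add_nonpos_nonpos less_imp_le min.absorb1 order_trans)
  ultimately have "max (g x + g y) (g bot) \<in> range g" by (auto simp: max_def)
  then show ?thesis using assms by (simp add: op_def f_inv_into_f)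
qed

lemma op_neg_neg_less:
  assumes "g x < 0" "g y < 0"
  shows "g (op x y) < 0"
proof -
  have "g x + g y < 0" using assms by (cases "g x"; cases "g y") auto
  then show ?thesis
    using le_less_trans[OF g_bot_le assms(1)] by (simp add: op_neg_neg[OF assms])
qed

lemma op_neg: "g x < 0 \<Longrightarrow> \<not> g y < 0 \<Longrightarrow> op x y = x" "g x < 0 \<Longrightarrow> \<not> g y < 0 \<Longrightarrow> op y x = x"
  by (simp_all add: op_def)

lemma op_low_low:
  assumes "0 \<le> g x" "0 \<le> g y" "x \<le> a" "y \<le> a"
  shows "g (op x y) = min (g x + g y) (g a)"
proof -
  have "(g x, g y) \<in> region_inc g a" using assms by (auto simp: region_inc_def g_le)
  then have "min (g x + g y) (g a) \<in> range g \<union> {-\<infinity>..<g bot}"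
    using A1 unfolding A1_def by blast
  moreover have "\<not> min (g x + g y) (g a) < g bot"
    using assms g_a_nonneg g_bot_nonpos
    by (metis add_nonneg_nonneg leD min_def order_trans)
  ultimately have "min (g x + g y) (g a) \<in> range g" by auto
  moreover have "\<not> g x < 0" "\<not> g y < 0" using assms by auto
  ultimately show ?thesis using assms by (simp add: op_def f_inv_into_f)
qed

text \<open>A value at most \<open>g a\<close> does not yet give \<open>op x y \<le> a\<close>, as
  the result might be incomparable with \<open>a\<close>. If a value is 0 or the sum reaches
  \<open>g a\<close>, the result is \<open>x\<close>, \<open>y\<close> or \<open>a\<close>;
  otherwise both values lie strictly between 0 and \<open>g a\<close>, and \<open>A5\<close>
  excludes incomparability.\<close>

lemma op_low_low_bounds:
  assumes "0 \<le> g x" "0 \<le> g y" "x \<le> a" "y \<le> a"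
  shows "0 \<le> g (op x y)" "op x y \<le> a"
proof -
  show "0 \<le> g (op x y)" using assms g_a_nonneg by (simp add: op_low_low)
  have gle: "g (op x y) \<le> g a" using assms by (simp add: op_low_low)
  have eq: "op x y = u" if "g (op x y) = g u" for u
    using that g_eq by simp
  show "op x y \<le> a"
  proof (cases "g x = 0 \<or> g y = 0 \<or> g a \<le> g x + g y")
    case True
    then have "g (op x y) = g x \<or> g (op x y) = g y \<or> g (op x y) = g a"
      unfolding op_low_low[OF assms] using assms g_le by (auto simp: min_def)
    then show ?thesis using eq assms by auto
  next
    case False
    with assms have pos: "0 < g x" "0 < g y" and lt: "g x + g y < g a" by auto
    then have "g x < g a" "g y < g a"
      by (metis add_increasing2 assms(2) le_less_trans order_refl)
        (metis add_increasing lt assms(1) le_less_trans order_refl)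
    moreover have val: "g (op x y) = g x + g y" using lt op_low_low[OF assms] by auto
    moreover have "0 < g x + g y" using pos by (simp add: add_pos_pos)
    ultimately have "comparable (inv g (g x + g y)) a"
      using A5 pos lt unfolding A5_def by (metis greaterThanLessThan_iff less_imp_le rangeI)
    then show ?thesis
      using gle le_if_comparable by (simp flip: val add: inv_g)
  qed
qed

lemma op_mixed:
  assumes "0 \<le> g x" "0 \<le> g y" "\<not> (x \<le> a \<and> y \<le> a)" "\<not> (a < x \<and> a < y)"
  shows "op x y = a"
  using assms by (auto simp: op_def)

lemma op_high_high:
  assumes "a < x" "a < y"
  shows "g (op x y) = upper (g x) (g y)"
proof -
  have "\<not> g x < 0" "\<not> g y < 0" "\<not> x \<le> a"
    using assms neg_le_a by (auto dest: leD)
  moreover have "upper (g x) (g y) \<in> range g" by (auto simp: upper_def min_def max_def)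
  ultimately show ?thesis using assms by (simp add: op_def f_inv_into_f)
qed

lemma op_high_high_above:
  assumes "a < x" "a < y"
  shows "a < op x y"
  using assms by (simp add: above_a_iff op_high_high upper_def less_max_iff_disj)

lemma op_nonneg:
  assumes "0 \<le> g x" "0 \<le> g y"
  shows "0 \<le> g (op x y)"
proof -
  consider "x \<le> a \<and> y \<le> a" | "a < x \<and> a < y" | "op x y = a"
    using op_mixed[OF assms] by blast
  then show ?thesis
  proof cases
    case 1
    then show ?thesis using assms op_low_low_bounds by blast
  next
    case 2
    then have "g a \<le> g (op x y)"
      using op_high_high_above by (simp add: g_less less_imp_le)
    with g_a_nonneg show ?thesis by (rule order_trans)
  next
    case 3
    then show ?thesis using g_a_nonneg by simp
  qed
qed

lemma op_le_a:
  assumes "0 \<le> g x" "0 \<le> g y" "\<not> (a < x \<and> a < y)"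
  shows "op x y \<le> a"
proof (cases "x \<le> a \<and> y \<le> a")
  case True
  with assms show ?thesis using op_low_low_bounds by blast
next
  case False
  with assms show ?thesis by (simp add: op_mixed)
qed

lemma op_a:
  assumes "0 \<le> g y"
  shows "op a y = a" "op y a = a"
proof -
  have "op a y = a"
  proof (cases "y \<le> a")
    case True
    then have "g (op a y) = g a"
      using assms g_a_nonneg by (simp add: op_low_low add_increasing2 min_absorb2)
    then show ?thesis by (simp add: g_eq)
  next
    case False
    then show ?thesis using assms g_a_nonneg by (simp add: op_mixed)
  qed
  then show "op a y = a" "op y a = a" by (simp_all add: op_commute[of y])
qed

section \<open>Associativity\<close>

lemma op_assoc_nonneg:
  assumes nn: "0 \<le> g x" "0 \<le> g y" "0 \<le> g z"
  shows "op (op x y) z = op x (op y z)"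
proof -
  \<comment> \<open>In the two homogeneous cases the values are combined by truncated addition or by
    \<open>upper\<close>; for a mixed triple both bracketings equal \<open>a\<close>.\<close>
  consider "x \<le> a" "y \<le> a" "z \<le> a" | "a < x" "a < y" "a < z"
    | "\<not> (x \<le> a \<and> y \<le> a \<and> z \<le> a)" "\<not> (a < x \<and> a < y \<and> a < z)"
    by blast
  then show ?thesis
  proof cases
    case 1
    note xy = op_low_low_bounds[OF nn(1,2) 1(1,2)] and yz = op_low_low_bounds[OF nn(2,3) 1(2,3)]
    have "g (op (op x y) z) = g (op x (op y z))"
      unfolding op_low_low[OF xy(1) nn(3) xy(2) 1(3)] op_low_low[OF nn(1) yz(1) 1(1) yz(2)]
        op_low_low[OF nn(1,2) 1(1,2)] op_low_low[OF nn(2,3) 1(2,3)]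
      by (rule ereal_truncated_add_assoc_le[OF nn])
    then show ?thesis by (simp add: g_eq)
  next
    case 2
    have "upper (upper s t) r = upper s (upper t r)" for s t r
      by (auto simp: upper_def min_def max_def)
    with 2 have "g (op (op x y) z) = g (op x (op y z))"
      by (simp add: op_high_high op_high_high_above)
    then show ?thesis by (simp add: g_eq)
  next
    case 3
    \<comment> \<open>Stated for arbitrary arguments, so that commutativity also yields the other
      bracketing.\<close>
    have L: "op (op u v) w = a"
      if "0 \<le> g u" "0 \<le> g v" "0 \<le> g w" "\<not> (u \<le> a \<and> v \<le> a \<and> w \<le> a)" "\<not> (a < u \<and> a < v \<and> a < w)"
      for u v w
    proof (cases "u \<le> a \<and> v \<le> a")
      case True
      then show ?thesis
        using that op_low_low_bounds[of u v] by (intro op_mixed) (auto dest: leD)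
    next
      case F: False
      show ?thesis
      proof (cases "a < u \<and> a < v")
        case True
        then show ?thesis
          using that op_high_high_above[of u v] op_nonneg[of u v]
          by (intro op_mixed) (auto dest: leD)
      next
        case False
        then show ?thesis using F that by (simp add: op_mixed[of u v] op_a)
      qed
    qed
    have "op x (op y z) = op (op y z) x" by (rule op_commute)
    also have "\<dots> = a" using 3 nn by (intro L) auto
    finally show ?thesis using L[OF nn 3] by simp
  qed
qed

text \<open>A non-negative factor leaves a negative one unchanged, and both sign classes are closed
  under \<open>op\<close>. So non-negative factors drop out next to negative ones, and only triples
  of constant sign need a computation.\<close>

lemma op_assoc: "op (op x y) z = op x (op y z)"
proof -
  note negs = op_neg op_neg_neg_less op_nonneg
  show ?thesis
  proof (cases "g x < 0 \<and> g y < 0 \<and> g z < 0")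
    case True
    then have "g (op (op x y) z) = max (max (g x + g y) (g bot) + g z) (g bot)"
      "g (op x (op y z)) = max (g x + max (g y + g z) (g bot)) (g bot)"
      using op_neg_neg_less[of x y] op_neg_neg_less[of y z] by (metis op_neg_neg)+
    with True have "g (op (op x y) z) = g (op x (op y z))"
      by (simp add: ereal_truncated_add_assoc_ge less_imp_le)
    then show ?thesis by (simp add: g_eq)
  next
    case False
    then show ?thesis
      using op_assoc_nonneg[of x y z]
      by (cases "g x < 0"; cases "g y < 0"; cases "g z < 0") (simp_all add: negs leD not_less)
  qed
qed

section \<open>Neutral elements\<close>

lemma op_e1:
  assumes "x \<le> a"
  shows "op e1 x = x"
proof (cases "g x < 0")
  case True
  then show ?thesis by (simp add: op_neg g_e1)
next
  case False
  then have "g (op e1 x) = g x"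
    using assms e1_le_a by (simp add: op_low_low g_e1 g_le min_absorb1)
  then show ?thesis by (simp add: g_eq)
qed

lemma op_e2:
  assumes "a \<le> x"
  shows "op e2 x = x"
proof (cases "x = a")
  case True
  then show ?thesis using op_a(2)[of e2] g_a_nonneg g_le[OF a_le_e2] by (auto intro: order_trans)
next
  case False
  with assms have x: "a < x" by auto
  \<comment> \<open>The alternative \<open>a = top\<close> in \<open>a_e2\<close> contradicts
    \<open>a < x\<close>, so \<open>op_high_high\<close> applies to \<open>e2\<close>.\<close>
  then have "a < e2" using a_e2 by (auto dest: leD)
  with x have "g (op e2 x) = g x"
    by (auto simp: op_high_high upper_def min_def max_def)
  then show ?thesis by (simp add: g_eq)
qed

section \<open>Monotonicity\<close>

lemma summand_add:
  assumes "g u = g x + g y" "g y \<noteq> 0" "0 \<le> g x \<and> 0 \<le> g y \<or> g x \<le> 0 \<and> g y \<le> 0"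
  shows "summand (range g) (g y) (g u)"
proof -
  have "g u \<noteq> 0" using assms by (cases "g x"; cases "g y") auto
  moreover have "0 \<le> g y * g x" using assms(3)
    by (auto simp: ereal_zero_le_0_iff)
  ultimately show ?thesis
    using assms(1,2) unfolding summand_def
    by (metis add.commute mult.commute rangeI)
qed

text \<open>This is how values yield order: a shared non-zero term is a common summand, so
  \<open>A2\<close> makes the two sums comparable, and their values decide the direction.\<close>

lemma le_of_common_summand:
  assumes "(g u, g v) \<in> region_inc g a" "g y \<noteq> 0" "g u = g x + g y" "g v = g x' + g y"
    and "g x \<le> g x'"
    and "0 \<le> g x \<and> 0 \<le> g x' \<and> 0 \<le> g y \<or> g x \<le> 0 \<and> g x' \<le> 0 \<and> g y \<le> 0"
  shows "u \<le> v"
proof -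
  have "summand (range g) (g y) (g u)" "summand (range g) (g y) (g v)"
    using assms summand_add[of u x y] summand_add[of v x' y] by auto
  then have "comparable u v"
    using A2 assms(1) unfolding A2_def common_summand_def by blast
  moreover have "g u \<le> g v" using assms by (simp add: add_right_mono)
  ultimately show ?thesis by (rule le_if_comparable)
qed

text \<open>Only the values of \<open>x\<close> and \<open>x'\<close> are compared, and
  \<open>x'\<close> may have value 0; this admits \<open>x' = e1\<close>, which gives
  \<open>op_neg_le\<close>. If the smaller sum is not truncated to \<open>bot\<close>,
  \<open>g y\<close> is a common summand of both results.\<close>

lemma op_neg_mono:
  assumes "g x \<le> g x'" "g x < 0" "g x' \<le> 0" "g y < 0"
  shows "op x y \<le> op x' y"
proof (cases "g x + g y \<le> g bot")
  case True
  then have "g (op x y) = g bot" using assms by (simp add: op_neg_neg)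
  then show ?thesis by (simp add: g_eq)
next
  case False
  then have "g x' + g y > g bot"
    using assms by (meson add_right_mono leD leI order_trans)
  moreover have "op x' y = y" if "g x' = 0"
    using that assms op_neg(2) by simp
  ultimately have *: "g (op x y) = g x + g y" "g (op x' y) = g x' + g y"
    using False assms by (cases "g x' = 0"; simp add: op_neg_neg)+
  show ?thesis
  proof (rule le_of_common_summand[OF _ _ * assms(1)])
    show "(g (op x y), g (op x' y)) \<in> region_inc g a"
      using assms by (simp add: * region_inc_def add_nonpos_nonpos)
  qed (use assms in auto)
qed

lemma op_neg_le:
  assumes "g x < 0" "g y < 0"
  shows "op x y \<le> y"
  using op_neg_mono[of x e1 y] assms by (simp add: g_e1 op_neg)

lemma op_low_mono:
  assumes "0 \<le> g x" "0 \<le> g y" "x \<le> x'" "x' \<le> a" "y \<le> a"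
  shows "op x y \<le> op x' y"
proof -
  have x: "x \<le> a" "0 \<le> g x'" "g x \<le> g x'"
    using assms g_le by (auto intro: order_trans)
  show ?thesis
  \<comment> \<open>A summand must be non-zero, so \<open>y = e1\<close> is separated and settled by
    neutrality.\<close>
  proof (cases "g y = 0")
    case True
    then have "y = e1" by (simp add: g_eq flip: g_e1)
    then show ?thesis using assms x by (simp add: op_commute[of _ e1] op_e1)
  next
    case y: False
    show ?thesis
    proof (cases "g a \<le> g x' + g y")
      case True
      then have "g (op x' y) = g a" using assms x by (simp add: op_low_low)
      then show ?thesis using assms x op_low_low_bounds by (simp add: g_eq)
    next
      case False
      moreover have "g x + g y \<le> g x' + g y" using x by (simp add: add_right_mono)
      ultimately have *: "g (op x y) = g x + g y" "g (op x' y) = g x' + g y"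
        using assms x by (auto simp: op_low_low min_def)
      show ?thesis
      proof (rule le_of_common_summand[OF _ y * x(3)])
        show "(g (op x y), g (op x' y)) \<in> region_inc g a"
          using assms x op_low_low_bounds[of x y] op_low_low_bounds[of x' y] g_le
          by (simp add: region_inc_def)
      qed (use assms x in auto)
    qed
  qed
qed

lemma op_low_ge:
  assumes "0 \<le> g x" "0 < g y" "x \<le> a" "y \<le> a"
  shows "y \<le> op x y"
proof (cases "g a \<le> g x + g y")
  case True
  then have "g (op x y) = g a" using assms by (simp add: op_low_low)
  then show ?thesis using assms by (simp add: g_eq)
next
  case False
  then have *: "g (op x y) = g x + g y" using assms by (simp add: op_low_low)
  \<comment> \<open>\<open>g y\<close> is a summand of itself, with \<open>g e1 = 0\<close> as the
    other term.\<close>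
  show ?thesis
  proof (rule le_of_common_summand[where x = e1 and x' = x and y = y])
    show "(g y, g (op x y)) \<in> region_inc g a"
      using assms op_low_low_bounds[of x y] g_le by (simp add: region_inc_def less_imp_le)
  qed (use assms * in \<open>auto simp: g_e1 less_imp_le\<close>)
qed

lemma op_high_mono:
  assumes "a < x" "x \<le> x'" "a < y"
  shows "op x y \<le> op x' y"
proof -
  have x': "a < x'" using assms by auto
  have "g x \<le> g x'" using assms g_le by blast
  then have "upper (g x) (g y) \<le> upper (g x') (g y)"
    by (auto simp: upper_def min_def max_def)
  then have "g (op x y) \<le> g (op x' y)"
    using assms x' by (simp add: op_high_high)
  moreover have "a < op x y" "a < op x' y"
    using assms x' by (simp_all add: op_high_high_above)
  ultimately show ?thesis by (simp add: le_above_a)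
qed

text \<open>This is where \<open>A3\<close> enters: if \<open>x' = e1\<close> and
  \<open>y \<le> a\<close>, the result is \<open>y\<close>, and \<open>A3\<close> compares
  \<open>x\<close> with it when \<open>g y\<close> is positive. If \<open>x'\<close> has positive
  value and both factors are at most \<open>a\<close>, then \<open>x' \<le> op x' y\<close>. In the
  remaining cases the result has value at least \<open>g a\<close>, and \<open>neg_le\<close>
  applies.\<close>

lemma neg_le_op:
  assumes "g x < 0" "0 \<le> g x'" "0 \<le> g y" "x \<le> x'"
  shows "x \<le> op x' y"
proof (cases "x' \<le> a \<and> y \<le> a")
  case True
  show ?thesis
  proof (cases "g x' = 0")
    case x': True
    then have "x' = e1" by (simp add: g_eq flip: g_e1)
    then have "op x' y = y" using True op_e1 by simp
    moreover have "x \<le> y"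
    proof (cases "g y = 0")
      case True
      then show ?thesis using assms \<open>x' = e1\<close> g_eq[of y e1] by (simp add: g_e1)
    next
      case False
      moreover have "x < e1" using assms \<open>x' = e1\<close> by (auto simp: less_le)
      ultimately have "comparable x y"
        using A3 assms True g_le[of y a] unfolding A3_def by (auto simp: less_le)
      then show ?thesis using assms by (intro le_if_comparable) auto
    qed
    ultimately show ?thesis by simp
  next
    case False
    then have "x' \<le> op x' y"
      using assms True op_low_ge[of y x'] op_commute[of y] by (auto simp: less_le)
    then show ?thesis using assms by auto
  qed
next
  case False
  have "g a \<le> g (op x' y)"
  proof (cases "a < x' \<and> a < y")
    case True
    then show ?thesis using op_high_high_above by (simp add: g_le less_imp_le)
  next
    case F: False
    then show ?thesis using False assms by (simp add: op_mixed)
  qed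
  then show ?thesis using assms neg_le by blast
qed

lemma op_mono:
  assumes "x \<le> x'"
  shows "op x y \<le> op x' y"
proof -
  have g: "g x \<le> g x'" using assms by (rule g_le)
  consider "g y < 0" "g x < 0" "g x' < 0" | "g y < 0" "g x < 0" "\<not> g x' < 0"
    | "g y < 0" "\<not> g x < 0" "\<not> g x' < 0"
    | "0 \<le> g y" "g x < 0" "g x' < 0" | "0 \<le> g y" "g x < 0" "0 \<le> g x'"
    | "0 \<le> g y" "0 \<le> g x" "0 \<le> g x'"
    using g by (metis le_less_trans not_less)
  then show ?thesis
  proof cases
    case 1
    then show ?thesis using g by (simp add: op_neg_mono)
  next
    case 2
    then show ?thesis by (simp add: op_neg op_neg_le)
  next
    case 3
    then show ?thesis by (simp add: op_neg)
  next
    case 4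
    then show ?thesis using assms by (simp add: op_neg)
  next
    case 5
    then show ?thesis using assms neg_le_op by (simp add: op_neg)
  next
    case 6
    \<comment> \<open>If \<open>y\<close> and \<open>x'\<close> are both above \<open>a\<close>, so
      is \<open>op x' y\<close>, while \<open>op x y\<close> is at most \<open>a\<close> unless
      \<open>x\<close> is above \<open>a\<close> too. Otherwise \<open>op x y\<close> is at most
      \<open>a\<close>, and \<open>op x' y\<close> equals \<open>a\<close> unless \<open>x'\<close>
      and \<open>y\<close> are both at most \<open>a\<close>.\<close>
    show ?thesis
    proof (cases "a < y \<and> a < x'")
      case True
      show ?thesis
      proof (cases "a < x")
        case False
        then have "op x y \<le> a" using 6 by (simp add: op_le_a)
        also have "a \<le> op x' y" using True op_high_high_above by (simp add: less_imp_le)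
        finally show ?thesis .
      qed (use True assms op_high_mono in auto)
    next
      case False
      show ?thesis
      proof (cases "x' \<le> a \<and> y \<le> a")
        case True
        then show ?thesis using 6 assms by (simp add: op_low_mono)
      next
        case F: False
        then have "op x' y = a" using 6 False by (intro op_mixed) auto
        moreover have "\<not> (a < x \<and> a < y)" using False assms by auto
        ultimately show ?thesis using 6 by (simp add: op_le_a)
      qed
    qed
  qed
qed

lemma aggregation_op: "aggregation op"
  unfolding aggregation_def
proof (intro conjI allI)
  show "abel_semigroup op"
  proof
    show "op (op x y) z = op x (op y z)" for x y z by (rule op_assoc)
    show "op x y = op y x" for x y by (rule op_commute)
  qed
  show "mono (\<lambda>x. op x y)" for y by (simp add: monoI op_mono)
  show "mono (op x)" for x
    unfolding mono_def using op_mono op_commute by metis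
qed

lemma two_uninorm_op: "two_uninorm e1 a e2 op"
  unfolding two_uninorm_def
  using e1_le_a a_le_e2 aggregation_op op_e1 op_e2 by blast

end

section \<open>Comparison with the displayed operations\<close>

text \<open>
  \<open>P\<close> stands for the pseudo-inverse of \<open>g\<close>, or for \<open>\<lambda>v. pinv f (- v)\<close> if \<open>g\<close> is \<open>- f\<close> for a
  decreasing \<open>f\<close>.
\<close>

locale generator_pinv = generator +
  fixes P :: "ereal \<Rightarrow> 'a option"
  assumes P_g: "P (g x) = Some x"
    and P_bot: "v < g bot \<Longrightarrow> P v = Some bot"
    and P_top: "g top < v \<Longrightarrow> P v = Some top"
begin

lemma P_nonpos:
  assumes "g x \<le> 0" "g y \<le> 0"
  shows "P (g x + g y) = Some (op x y)"
proof -
  have e1: "z = e1" if "g z = 0" for z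
    using that by (simp add: g_eq flip: g_e1)
  have le: "z \<le> a" if "g z \<le> 0" for z
    using that neg_le_a[of z] e1[of z] e1_le_a by (auto simp: le_less)
  \<comment> \<open>\<open>op\<close> tests strict signs while this region contains 0; the value 0
    occurs only at the neutral \<open>e1\<close>. A sum below \<open>g bot\<close> is sent to
    \<open>bot\<close> by \<open>P\<close>, matching the truncation in \<open>op\<close>.\<close>
  consider "g x = 0" | "g y = 0" | "g x < 0" "g y < 0" using assms by fastforce
  then show ?thesis
  proof cases
    case 1
    then show ?thesis using e1[of x] op_e1[OF le] assms by (simp add: P_g)
  next
    case 2
    then show ?thesis using e1[of y] op_e1[OF le] assms by (simp add: P_g op_commute[of x])
  next
    case 3
    show ?thesis
    proof (cases "g x + g y < g bot")
      case True
      then have "g (op x y) = g bot" using 3 by (simp add: op_neg_neg max_absorb2 less_imp_le)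
      then show ?thesis using True by (simp add: g_eq P_bot)
    next
      case False
      then have "g (op x y) = g x + g y" using 3 by (simp add: op_neg_neg max_absorb1)
      then show ?thesis by (metis P_g)
    qed
  qed
qed

lemma P_low:
  assumes "0 \<le> g x" "0 \<le> g y" "x \<le> a" "y \<le> a"
  shows "P (min (g x + g y) (g a)) = Some (op x y)"
  unfolding op_low_low[OF assms, symmetric] by (rule P_g)

lemma P_opposite:
  assumes "g x < 0 \<and> 0 < g y \<or> 0 < g x \<and> g y < 0"
  shows "P (min (g x) (g y)) = Some (op x y)"
proof -
  have "min (g x) (g y) = g (op x y)"
    using assms by (auto simp: op_neg)
  then show ?thesis by (simp add: P_g)
qed

lemma P_high:
  assumes "a < x" "a < y"
  shows "P (upper (g x) (g y)) = Some (op x y)"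
  unfolding op_high_high[OF assms, symmetric] by (rule P_g)

lemma upper_top: "e2 = top \<Longrightarrow> upper (g x) (g y) = min (g x) (g y)"
  unfolding upper_def using g_le_top by simp

text \<open>Here the sum is not truncated, but \<open>P\<close> sends a sum above
  \<open>g top\<close> to \<open>top\<close>, just as truncation at \<open>g a = g top\<close>
  does.\<close>

lemma P_nonneg_top:
  assumes "a = top" "0 \<le> g x" "0 \<le> g y"
  shows "P (g x + g y) = Some (op x y)"
proof (cases "g top < g x + g y")
  case True
  then have "g (op x y) = g top" using assms op_low_low[of x y] by simp
  then show ?thesis using True by (simp add: g_eq P_top)
next
  case False
  then show ?thesis using assms P_low[of x y] by (simp add: min_absorb1)
qed

lemma op_cases [case_names nonpos low mixed high opposite]:
  obtains "g x \<le> 0" "g y \<le> 0"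
  | "\<not> (g x \<le> 0 \<and> g y \<le> 0)" "0 \<le> g x" "0 \<le> g y" "x \<le> a" "y \<le> a"
  | "\<not> (g x \<le> 0 \<and> g y \<le> 0)" "0 \<le> g x" "0 \<le> g y"
    "\<not> (x \<le> a \<and> y \<le> a)" "\<not> (a < x \<and> a < y)"
  | "0 < g x" "0 < g y" "a < x" "a < y"
  | "g x < 0 \<and> 0 < g y \<or> 0 < g x \<and> g y < 0"
proof -
  have "0 < g z" if "a < z" for z
    using that g_a_nonneg g_less[of a z] by auto
  then show ?thesis using that by (meson not_less less_imp_le)
qed

section \<open>The displayed regions expressed through \<open>g\<close>\<close>

lemma F_set_iff: "g z \<in> F_set g a \<longleftrightarrow> z \<in> incomp a"
  using incomp_bounds by (auto simp: F_set_def g_eq)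

lemma G_set_iff: "- g z \<in> G_set (\<lambda>x. - g x) a \<longleftrightarrow> z \<in> incomp a"
  using incomp_bounds by (auto simp: G_set_def g_eq ereal_uminus_less_reorder)

lemma zero_region_inc_iff:
  "(g x, g y) \<in> zero_region_inc g a \<longleftrightarrow> 0 \<le> g x \<and> 0 \<le> g y \<and>
     (g a \<le> g x \<and> g y \<le> g a \<or> g x \<le> g a \<and> g a \<le> g y \<or>
      g x \<le> g a \<and> y \<in> incomp a \<or> x \<in> incomp a \<and> g y \<le> g a)"
  using g_a_nonneg incomp_bounds[of x] incomp_bounds[of y]
  by (auto simp: zero_region_inc_def F_set_iff)

lemma zero_region_dec_iff:
  "(- g x, - g y) \<in> zero_region_dec (\<lambda>x. - g x) a \<longleftrightarrow> 0 \<le> g x \<and> 0 \<le> g y \<and>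
     (g a < g x \<and> g y \<le> g a \<or> g x \<le> g a \<and> g a < g y \<or>
      g x \<le> g a \<and> y \<in> incomp a \<or> x \<in> incomp a \<and> g y \<le> g a)"
  using g_a_nonneg incomp_bounds[of x] incomp_bounds[of y]
  by (auto simp: zero_region_dec_def G_set_iff)

text \<open>Turns the order tests of \<open>op\<close> into the conditions on values that describe
  the zero regions, so that the two case distinctions can be matched.\<close>

lemma mixed_iff:
  "\<not> (x \<le> a \<and> y \<le> a) \<and> \<not> (a < x \<and> a < y) \<longleftrightarrow>
     x \<in> incomp a \<and> g y \<le> g a \<or> g x \<le> g a \<and> y \<in> incomp a \<or>
     g a < g x \<and> g y \<le> g a \<or> g x \<le> g a \<and> g a < g y"
  using incomp_bounds[of x] incomp_bounds[of y]
  by (auto simp: le_a_iff above_a_iff)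

section \<open>Agreement of \<open>op\<close> with the displayed formulas\<close>

lemma uni_null_inc_eq:
  assumes "P = pinv g" "e2 = top"
  shows "uni_null_inc g a x y = Some (op x y)"
proof (cases rule: op_cases[of x y])
  case nonpos
  then show ?thesis using P_nonpos by (simp add: uni_null_inc_def assms)
next
  case low
  then show ?thesis using P_low by (auto simp: uni_null_inc_def assms le_a_iff)
next
  case mixed
  then show ?thesis using mixed_iff[of x y]
    by (auto simp: uni_null_inc_def zero_region_inc_iff le_a_iff op_mixed)
next
  case high
  then show ?thesis using P_high upper_top incomp_bounds[of x] incomp_bounds[of y]
    by (auto simp: uni_null_inc_def zero_region_inc_iff assms above_a_iff)
next
  case opposite
  then show ?thesis using P_opposite
    by (auto simp: uni_null_inc_def zero_region_inc_iff assms)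
qed

lemma uni_inc_eq:
  assumes "P = pinv g" "a = top"
  shows "uni_inc g x y = Some (op x y)"
proof -
  consider "g x \<le> 0" "g y \<le> 0" | "0 \<le> g x" "0 \<le> g y"
    | "g x < 0 \<and> 0 < g y \<or> 0 < g x \<and> g y < 0"
    by (metis not_less order_less_imp_le)
  then show ?thesis
  proof cases
    case 1
    then show ?thesis using P_nonpos[of x y] by (simp add: uni_inc_def assms)
  next
    case 2
    then show ?thesis using P_nonneg_top[of x y] by (simp add: uni_inc_def assms)
  next
    case 3
    then show ?thesis using P_opposite[of x y] by (auto simp: uni_inc_def assms)
  qed
qed

context
  assumes nonneg: "\<And>z. 0 \<le> g z"
begin

lemma null_uni_inc_eq:
  assumes "P = pinv g"
  shows "null_uni_inc g a e2 x y = Some (op x y)"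
proof -
  consider "x \<le> a" "y \<le> a" | "\<not> (x \<le> a \<and> y \<le> a)" "\<not> (a < x \<and> a < y)" | "a < x" "a < y"
    by blast
  then show ?thesis
  proof cases
    case 1
    then show ?thesis using P_low[of x y] nonneg
      by (simp add: null_uni_inc_def assms le_a_iff)
  next
    case 2
    then show ?thesis using mixed_iff[of x y] nonneg
      by (auto simp: null_uni_inc_def zero_region_inc_iff le_a_iff op_mixed)
  next
    case 3
    then show ?thesis using P_high[of x y] incomp_bounds[of x] incomp_bounds[of y]
      by (auto simp: null_uni_inc_def zero_region_inc_iff assms above_a_iff upper_def)
  qed
qed

lemma null_inc_eq:
  assumes "P = pinv g" "e2 = top"
  shows "null_inc g a x y = Some (op x y)"
proof -
  consider "x \<le> a" "y \<le> a" | "\<not> (x \<le> a \<and> y \<le> a)" "\<not> (a < x \<and> a < y)" | "a < x" "a < y"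
    by blast
  then show ?thesis
  proof cases
    case 1
    then show ?thesis using P_low[of x y] nonneg
      by (simp add: null_inc_def assms le_a_iff)
  next
    case 2
    then show ?thesis using mixed_iff[of x y] nonneg
      by (auto simp: null_inc_def zero_region_inc_iff le_a_iff op_mixed)
  next
    case 3
    then show ?thesis using P_high[of x y] upper_top incomp_bounds[of x] incomp_bounds[of y]
      by (auto simp: null_inc_def zero_region_inc_iff assms above_a_iff)
  qed
qed

lemma null_uni_dec_eq:
  assumes "P = (\<lambda>v. pinv (\<lambda>x. - g x) (- v))"
  shows "null_uni_dec (\<lambda>x. - g x) a e2 x y = Some (op x y)"
proof -
  have sum: "- g x + - g y = - (g x + g y)"
    using nonneg by (simp add: ereal_uminus_add_same_sign)
  consider "x \<le> a" "y \<le> a" | "\<not> (x \<le> a \<and> y \<le> a)" "\<not> (a < x \<and> a < y)" | "a < x" "a < y"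
    by blast
  then show ?thesis
  proof cases
    case 1
    then show ?thesis using P_low[of x y] nonneg
      by (simp add: null_uni_dec_def sum assms le_a_iff flip: ereal_min_uminus)
  next
    case 2
    then show ?thesis using mixed_iff[of x y] nonneg
      by (auto simp: null_uni_dec_def zero_region_dec_iff le_a_iff op_mixed)
  next
    case 3
    then show ?thesis using P_high[of x y] incomp_bounds[of x] incomp_bounds[of y]
      by (auto simp: null_uni_dec_def zero_region_dec_iff assms above_a_iff upper_def
          simp flip: ereal_min_uminus ereal_max_uminus)
  qed
qed

lemma null_dec_eq:
  assumes "P = (\<lambda>v. pinv (\<lambda>x. - g x) (- v))" "e2 = top"
  shows "null_dec (\<lambda>x. - g x) a x y = Some (op x y)"
proof -
  have sum: "- g x + - g y = - (g x + g y)"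
    using nonneg by (simp add: ereal_uminus_add_same_sign)
  consider "x \<le> a" "y \<le> a" | "\<not> (x \<le> a \<and> y \<le> a)" "\<not> (a < x \<and> a < y)" | "a < x" "a < y"
    by blast
  then show ?thesis
  proof cases
    case 1
    then show ?thesis using P_low[of x y] nonneg
      by (simp add: null_dec_def sum assms le_a_iff flip: ereal_min_uminus)
  next
    case 2
    then show ?thesis using mixed_iff[of x y] nonneg
      by (auto simp: null_dec_def zero_region_dec_iff le_a_iff op_mixed)
  next
    case 3
    then show ?thesis using P_high[of x y] upper_top incomp_bounds[of x] incomp_bounds[of y]
      by (auto simp: null_dec_def zero_region_dec_iff assms above_a_iff
          simp flip: ereal_min_uminus)
  qed
qed

end

text \<open>The first branch of \<open>uni_null_dec\<close> is open at 0, unlike that of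
  \<open>uni_null_inc\<close>. Two zero values therefore fall into the truncated sum, and a zero
  paired with a negative value of \<open>g\<close> into the last branch, which picks the same
  element as \<open>op\<close>.\<close>

lemma uni_null_dec_eq:
  assumes "P = (\<lambda>v. pinv (\<lambda>x. - g x) (- v))" "e2 = top"
  shows "uni_null_dec (\<lambda>x. - g x) a x y = Some (op x y)"
proof (cases rule: op_cases[of x y])
  case nonpos
  have sum: "- g x + - g y = - (g x + g y)"
    using nonpos by (simp add: ereal_uminus_add_same_sign)
  consider "g x < 0" "g y < 0" | "g x = 0" "g y = 0" | "g x < 0 \<and> g y = 0 \<or> g x = 0 \<and> g y < 0"
    using nonpos by (auto simp: le_less)
  then show ?thesis
  proof cases
    case 1
    then show ?thesis using P_nonpos[of x y]
      by (simp add: uni_null_dec_def sum assms ereal_less_uminus_reorder)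
  next
    case 2
    then have "x \<le> a" "y \<le> a"
      using g_a_nonneg incomp_bounds[of x] incomp_bounds[of y] by (auto simp: le_a_iff)
    then show ?thesis using 2 P_low[of x y]
      by (auto simp: uni_null_dec_def sum assms le_a_iff simp flip: ereal_min_uminus)
  next
    case 3
    then have "min (g x) (g y) = g (op x y)" by (auto simp: op_neg)
    then have "P (min (g x) (g y)) = Some (op x y)" by (simp add: P_g)
    with 3 show ?thesis
      by (auto simp: uni_null_dec_def zero_region_dec_iff assms ereal_less_uminus_reorder
          simp flip: ereal_min_uminus)
  qed
next
  case low
  have sum: "- g x + - g y = - (g x + g y)"
    using low by (simp add: ereal_uminus_add_same_sign)
  show ?thesis using low P_low[of x y]
    by (auto simp: uni_null_dec_def sum assms le_a_iff ereal_less_uminus_reorder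
        simp flip: ereal_min_uminus)
next
  case mixed
  then show ?thesis using mixed_iff[of x y]
    by (auto simp: uni_null_dec_def zero_region_dec_iff le_a_iff op_mixed ereal_less_uminus_reorder)
next
  case high
  then show ?thesis using P_high upper_top incomp_bounds[of x] incomp_bounds[of y]
    by (auto simp: uni_null_dec_def zero_region_dec_iff assms above_a_iff
        ereal_less_uminus_reorder simp flip: ereal_min_uminus)
next
  case opposite
  then show ?thesis using P_opposite
    by (auto simp: uni_null_dec_def zero_region_dec_iff assms ereal_less_uminus_reorder
        simp flip: ereal_min_uminus)
qed

lemma uni_dec_eq:
  assumes "P = (\<lambda>v. pinv (\<lambda>x. - g x) (- v))" "a = top"
  shows "uni_dec (\<lambda>x. - g x) x y = Some (op x y)"
proof -
  consider "g x \<le> 0" "g y \<le> 0" | "0 \<le> g x" "0 \<le> g y"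
    | "g x < 0 \<and> 0 < g y \<or> 0 < g x \<and> g y < 0"
    by (metis not_less order_less_imp_le)
  then show ?thesis
  proof cases
    case 1
    then have sum: "- g x + - g y = - (g x + g y)"
      by (simp add: ereal_uminus_add_same_sign)
    show ?thesis using 1 P_nonpos[of x y] by (simp add: uni_dec_def sum assms)
  next
    case 2
    then have sum: "- g x + - g y = - (g x + g y)"
      by (simp add: ereal_uminus_add_same_sign)
    show ?thesis using 2 P_nonneg_top[of x y] by (simp add: uni_dec_def sum assms)
  next
    case 3
    then show ?thesis using P_opposite[of x y]
      by (auto simp: uni_dec_def assms simp flip: ereal_min_uminus)
  qed
qed

end

section \<open>Generators from the conditions of the theorem\<close>

lemma generator_A4:
  assumes "e1 < a" "inj f" "mono f" "f e1 = 0" "A1 f a" "A2 f a" "A3 f e1 a" "A4 f a" "A5 f a"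
  shows "generator f e1 a top"
proof
  \<comment> \<open>The second alternative of \<open>A4\<close> asks for \<open>0 < f a\<close>;
    this comes from \<open>e1 < a\<close> and injectivity.\<close>
  have pos: "0 < f a"
    using assms monoD[OF assms(3), of e1 a] by (auto simp: less_le inj_eq simp flip: assms(4))
  show "A4' f a" using assms(8) unfolding A4_def A4'_def by blast
  show "x \<le> y" if "f x < 0" "f a \<le> f y" for x y
  proof -
    have "comparable x y" using assms(8) pos that unfolding A4_def by blast
    moreover have "\<not> f y \<le> f x" using that pos by auto
    ultimately show ?thesis using monoD[OF assms(3)] by (auto simp: comparable_def)
  qed
qed (use assms in \<open>auto simp: top.not_eq_extremum\<close>)

text \<open>Without negative values \<open>A3\<close> and \<open>neg_le\<close> hold
  vacuously.\<close>

lemma generator_nonneg: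
  assumes "a \<le> e2" "a < e2 \<or> a = top" "inj f" "mono f" "range f \<subseteq> {0..\<infinity>}" "f bot = 0"
    "A1 f a" "A2 f a" "A4' f a" "A5 f a"
  shows "generator f bot a e2"
proof
  have nn: "\<not> f x < 0" for x using range_subsetD[OF assms(5), of x] by auto
  show "A3 f bot a" using nn by (simp add: A3_def)
  show "x \<le> y" if "f x < 0" for x y using nn that by blast
qed (use assms in auto)

text \<open>No value exceeds \<open>f top\<close> and only \<open>top\<close> attains it, which
  gives \<open>A4'\<close> and \<open>neg_le\<close>; \<open>A5\<close> holds because every element
  is comparable with \<open>top\<close>.\<close>

lemma generator_top:
  assumes "inj f" "mono f" "f e1 = 0" "A1 f top" "A2 f top" "A3 f e1 top"
  shows "generator f e1 top top"
proof
  have le: "f x \<le> f top" for x using assms(2) by (simp add: monoD)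
  show "A4' f top" unfolding A4'_def using le by (meson leD le_less_trans)
  show "A5 f top" by (simp add: A5_def comparable_def)
  show "x \<le> y" if "f top \<le> f y" for x y
    using that le[of y] assms(1) by (simp add: order_antisym inj_eq)
qed (use assms in auto)

lemma generator_pinv_mono:
  assumes "generator f e1 a e2"
  shows "generator_pinv f e1 a e2 (pinv f)"
proof -
  interpret generator f e1 a e2 by fact
  show ?thesis
    by unfold_locales (simp_all add: pinv_f_f inj_g mono_g pinv_below_mono pinv_above_mono)
qed

lemma generator_pinv_antimono:
  assumes "inj f" "antimono f" "generator (\<lambda>x. - f x) e1 a e2"
  shows "generator_pinv (\<lambda>x. - f x) e1 a e2 (\<lambda>v. pinv f (- v))"
proof -
  interpret generator "\<lambda>x. - f x" e1 a e2 by fact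
  show ?thesis
    by unfold_locales (simp_all add: pinv_f_f assms pinv_below_antimono pinv_above_antimono
        ereal_less_uminus_reorder ereal_uminus_less_reorder)
qed

section \<open>Passing from \<open>f\<close> to \<open>- f\<close>\<close>

lemma range_uminus_iff: "- u \<in> range (\<lambda>x. - f x) \<longleftrightarrow> u \<in> range f" for u :: ereal
  by auto

lemma summand_uminus:
  assumes "summand (range f) s x"
  shows "summand (range (\<lambda>x. - f x)) (- s) (- x)"
proof -
  from assms obtain b where b: "b \<in> range f" "x = s + b" "0 \<le> s * b"
    and s: "s \<in> range f" "x \<in> range f" "s \<noteq> 0" "x \<noteq> 0"
    unfolding summand_def by blast
  have "- s + - b = - x"
    unfolding b(2) using b(3) s(3) by (intro ereal_uminus_add_same_sign) (auto simp: ereal_zero_le_0_iff)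
  moreover have "0 \<le> - s * - b" using b(3) by simp
  ultimately show ?thesis
    unfolding summand_def using b s by (metis range_uminus_iff ereal_uminus_zero_iff)
qed

context
  fixes f :: "'a::bounded_lattice \<Rightarrow> ereal" and a :: 'a
begin

lemma inj_uminus: "inj f \<Longrightarrow> inj (\<lambda>x. - f x)"
  by (simp add: inj_def)

lemma mono_uminus: "antimono f \<Longrightarrow> mono (\<lambda>x. - f x)"
  by (simp add: monotone_def)

lemma region_uminus:
  "(- f x, - f y) \<in> region_inc (\<lambda>x. - f x) a \<longleftrightarrow> (f x, f y) \<in> region_dec f a"
  by (auto simp: region_inc_def region_dec_def)

lemma A1_uminus:
  assumes "D1 f a"
  shows "A1 (\<lambda>x. - f x) a"
  unfolding A1_def
proof (intro allI impI)
  fix x y assume r: "(- f x, - f y) \<in> region_inc (\<lambda>x. - f x) a"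
  then have *: "(f x, f y) \<in> region_dec f a" by (simp add: region_uminus)
  then have "- f x + - f y = - (f x + f y)"
    by (intro ereal_uminus_add_same_sign) (auto simp: region_dec_def)
  then have eq: "min (- f x + - f y) (- f a) = - max (f x + f y) (f a)"
    by (simp add: ereal_max_uminus)
  have "max (f x + f y) (f a) \<in> range f \<union> {f bot<..\<infinity>}"
    using * assms unfolding D1_def by blast
  then show "min (- f x + - f y) (- f a) \<in> range (\<lambda>x. - f x) \<union> {-\<infinity>..<- f bot}"
    unfolding eq by (auto simp: range_uminus_iff)
qed

lemma A2_uminus:
  assumes "D2 f a"
  shows "A2 (\<lambda>x. - f x) a"
  unfolding A2_def
proof (intro allI impI; elim conjE)
  fix x y
  assume r: "(- f x, - f y) \<in> region_inc (\<lambda>x. - f x) a" and c: "common_summand (\<lambda>x. - f x) x y"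
  \<comment> \<open>\<open>summand_uminus\<close> is applied to \<open>- f\<close>, whose negation
    is \<open>f\<close> again.\<close>
  from c have "common_summand f x y"
    unfolding common_summand_def using summand_uminus[of "\<lambda>x. - f x"] by fastforce
  with r assms show "comparable x y"
    unfolding D2_def region_uminus by blast
qed

lemma A3_uminus: "D3 f e1 a \<Longrightarrow> A3 (\<lambda>x. - f x) e1 a"
  unfolding D3_def A3_def comparable_def
  by (auto simp: ereal_less_uminus_reorder ereal_uminus_less_reorder)

lemma A4_uminus: "D4 f a \<Longrightarrow> A4 (\<lambda>x. - f x) a"
  unfolding D4_def A4_def comparable_def
  by (auto simp: ereal_less_uminus_reorder ereal_uminus_less_reorder)

lemma A4'_uminus: "D4' f a \<Longrightarrow> A4' (\<lambda>x. - f x) a"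
  unfolding D4'_def A4'_def comparable_def by auto

lemma A5_uminus:
  assumes "inj f" "D5 f a"
  shows "A5 (\<lambda>x. - f x) a"
  unfolding A5_def
proof (intro allI impI; elim conjE)
  fix x y
  assume r: "- f x \<in> {0<..<- f a}" "- f y \<in> {0<..<- f a}"
    "- f x + - f y \<in> range (\<lambda>x. - f x)" "0 < - f x + - f y" "- f x + - f y \<le> - f a"
  then have neg: "f x < 0" "f y < 0" by (simp_all add: ereal_less_uminus_reorder)
  then have sum: "- f x + - f y = - (f x + f y)"
    by (intro ereal_uminus_add_same_sign) auto
  from r(3) obtain z where z: "f x + f y = f z"
    unfolding sum range_uminus_iff by auto
  have "comparable (inv f (f x + f y)) a"
    using assms(2) r unfolding D5_def sum
    by (simp add: ereal_less_uminus_reorder range_uminus_iff)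
  \<comment> \<open>Both inverses return the same preimage \<open>z\<close>.\<close>
  then show "comparable (inv (\<lambda>x. - f x) (- f x + - f y)) a"
    using inv_f_f[OF inj_uminus[OF assms(1)], of z] assms(1) by (simp add: sum z)
qed

end

section \<open>Special classes obtained from 2-uninorms\<close>

lemma aggregation_commute: "aggregation F \<Longrightarrow> F x y = F y x"
  unfolding aggregation_def by (simp add: abel_semigroup.commute)

lemma two_uninorm_imp_uni_nullnorm:
  assumes "two_uninorm e1 a top F" "e1 < a"
  shows "uni_nullnorm F"
  using assms aggregation_commute[of F] unfolding two_uninorm_def uni_nullnorm_def
  by (metis atLeastAtMost_iff)

lemma two_uninorm_imp_nullnorm:
  assumes "two_uninorm bot a top F"
  shows "nullnorm F"
  using assms aggregation_commute[of F] unfolding two_uninorm_def nullnorm_def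
  by (metis atLeastAtMost_iff)

lemma two_uninorm_imp_uninorm:
  assumes "two_uninorm e1 top top F"
  shows "uninorm F \<and> (e1 = top \<longrightarrow> t_norm F) \<and> (e1 = bot \<longrightarrow> t_conorm F)"
  using assms aggregation_commute[of F]
  unfolding two_uninorm_def uninorm_def t_norm_def t_conorm_def
  by (metis top_greatest)

theorem corollary3p1:
  fixes f :: "'a::bounded_lattice \<Rightarrow> ereal" and e1 a e2 :: 'a
  assumes "bot \<le> e1" and "e1 \<le> a" and "a \<le> e2" and "e2 \<le> top"
  shows
    "(e2 = top \<and> e1 < a \<and> inj f \<and> mono f \<and> f e1 = 0 \<and>
        A1 f a \<and> A2 f a \<and> A3 f e1 a \<and> A4 f a \<and> A5 f a
        \<longrightarrow> (\<exists>U. total_op (uni_null_inc f a) U \<and> uni_nullnorm U)) \<and>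
     (e2 = top \<and> e1 < a \<and> inj f \<and> antimono f \<and> f e1 = 0 \<and>
        D1 f a \<and> D2 f a \<and> D3 f e1 a \<and> D4 f a \<and> D5 f a
        \<longrightarrow> (\<exists>U. total_op (uni_null_dec f a) U \<and> uni_nullnorm U)) \<and>
     (e1 = bot \<and> (a < e2 \<or> a = top) \<and> inj f \<and> mono f \<and> range f \<subseteq> {0..\<infinity>} \<and> f bot = 0 \<and>
        A1 f a \<and> A2 f a \<and> A4' f a \<and> A5 f a
        \<longrightarrow> (\<exists>N. total_op (null_uni_inc f a e2) N \<and> null_uninorm a e2 N)) \<and>
     (e1 = bot \<and> (a < e2 \<or> a = top) \<and> inj f \<and> antimono f \<and> range f \<subseteq> {-\<infinity>..0} \<and> f bot = 0 \<and>
        D1 f a \<and> D2 f a \<and> D4' f a \<and> D5 f a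
        \<longrightarrow> (\<exists>N. total_op (null_uni_dec f a e2) N \<and> null_uninorm a e2 N)) \<and>
     (e1 = bot \<and> e2 = top \<and> inj f \<and> mono f \<and> range f \<subseteq> {0..\<infinity>} \<and> f bot = 0 \<and>
        A1 f a \<and> A2 f a \<and> A4' f a \<and> A5 f a
        \<longrightarrow> (\<exists>N. total_op (null_inc f a) N \<and> nullnorm N)) \<and>
     (e1 = bot \<and> e2 = top \<and> inj f \<and> antimono f \<and> range f \<subseteq> {-\<infinity>..0} \<and> f bot = 0 \<and>
        D1 f a \<and> D2 f a \<and> D4' f a \<and> D5 f a
        \<longrightarrow> (\<exists>N. total_op (null_dec f a) N \<and> nullnorm N)) \<and>
     (a = top \<and> inj f \<and> mono f \<and> f e1 = 0 \<and>
        A1 f a \<and> A2 f a \<and> A3 f e1 a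
        \<longrightarrow> (\<exists>U. total_op (uni_inc f) U \<and> uninorm U \<and>
               (e1 = top \<longrightarrow> t_norm U) \<and> (e1 = bot \<longrightarrow> t_conorm U))) \<and>
     (a = top \<and> inj f \<and> antimono f \<and> f e1 = 0 \<and>
        D1 f a \<and> D2 f a \<and> D3 f e1 a
        \<longrightarrow> (\<exists>U. total_op (uni_dec f) U \<and> uninorm U))"
proof (intro conjI impI; elim conjE)
  assume h: "e2 = top" "e1 < a" "inj f" "mono f" "f e1 = 0"
    "A1 f a" "A2 f a" "A3 f e1 a" "A4 f a" "A5 f a"
  then interpret generator f e1 a top by (intro generator_A4)
  interpret generator_pinv f e1 a top "pinv f"
    by (rule generator_pinv_mono) unfold_locales
  show "\<exists>U. total_op (uni_null_inc f a) U \<and> uni_nullnorm U"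
    using uni_null_inc_eq two_uninorm_imp_uni_nullnorm[OF two_uninorm_op \<open>e1 < a\<close>]
    unfolding total_op_def by blast
next
  assume h: "e2 = top" "e1 < a" "inj f" "antimono f" "f e1 = 0"
    "D1 f a" "D2 f a" "D3 f e1 a" "D4 f a" "D5 f a"
  then interpret generator "\<lambda>x. - f x" e1 a top
    by (intro generator_A4)
      (simp_all add: inj_uminus mono_uminus A1_uminus A2_uminus A3_uminus A4_uminus A5_uminus)
  interpret generator_pinv "\<lambda>x. - f x" e1 a top "\<lambda>v. pinv f (- v)"
    using h(3,4) by (rule generator_pinv_antimono) unfold_locales
  show "\<exists>U. total_op (uni_null_dec f a) U \<and> uni_nullnorm U"
    using uni_null_dec_eq two_uninorm_imp_uni_nullnorm[OF two_uninorm_op \<open>e1 < a\<close>]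
    unfolding total_op_def by auto
next
  assume h: "e1 = bot" "a < e2 \<or> a = top" "inj f" "mono f" "range f \<subseteq> {0..\<infinity>}" "f bot = 0"
    "A1 f a" "A2 f a" "A4' f a" "A5 f a"
  with \<open>a \<le> e2\<close> interpret generator f bot a e2 by (intro generator_nonneg)
  interpret generator_pinv f bot a e2 "pinv f"
    by (rule generator_pinv_mono) unfold_locales
  have "0 \<le> f z" for z using range_subsetD[OF h(5), of z] by auto
  then show "\<exists>N. total_op (null_uni_inc f a e2) N \<and> null_uninorm a e2 N"
    using null_uni_inc_eq two_uninorm_op
    unfolding total_op_def null_uninorm_def by blast
next
  assume h: "e1 = bot" "a < e2 \<or> a = top" "inj f" "antimono f" "range f \<subseteq> {-\<infinity>..0}" "f bot = 0"
    "D1 f a" "D2 f a" "D4' f a" "D5 f a"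
  have nonneg: "0 \<le> - f z" for z using range_subsetD[OF h(5), of z] by auto
  from h \<open>a \<le> e2\<close> nonneg interpret generator "\<lambda>x. - f x" bot a e2
    by (intro generator_nonneg)
      (auto simp: inj_uminus mono_uminus A1_uminus A2_uminus A4'_uminus A5_uminus)
  interpret generator_pinv "\<lambda>x. - f x" bot a e2 "\<lambda>v. pinv f (- v)"
    using h(3,4) by (rule generator_pinv_antimono) unfold_locales
  show "\<exists>N. total_op (null_uni_dec f a e2) N \<and> null_uninorm a e2 N"
    using null_uni_dec_eq[OF nonneg] two_uninorm_op
    unfolding total_op_def null_uninorm_def by auto
next
  assume h: "e1 = bot" "e2 = top" "inj f" "mono f" "range f \<subseteq> {0..\<infinity>}" "f bot = 0"
    "A1 f a" "A2 f a" "A4' f a" "A5 f a"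
  \<comment> \<open>With \<open>e2 = top\<close> the alternative \<open>a < e2 \<or> a = top\<close>
    always holds.\<close>
  then interpret generator f bot a top
    by (intro generator_nonneg) (auto simp: top.not_eq_extremum)
  interpret generator_pinv f bot a top "pinv f"
    by (rule generator_pinv_mono) unfold_locales
  have "0 \<le> f z" for z using range_subsetD[OF h(5), of z] by auto
  then show "\<exists>N. total_op (null_inc f a) N \<and> nullnorm N"
    using null_inc_eq two_uninorm_imp_nullnorm[OF two_uninorm_op]
    unfolding total_op_def by blast
next
  assume h: "e1 = bot" "e2 = top" "inj f" "antimono f" "range f \<subseteq> {-\<infinity>..0}" "f bot = 0"
    "D1 f a" "D2 f a" "D4' f a" "D5 f a"
  have nonneg: "0 \<le> - f z" for z using range_subsetD[OF h(5), of z] by auto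
  from h nonneg interpret generator "\<lambda>x. - f x" bot a top
    by (intro generator_nonneg)
      (auto simp: inj_uminus mono_uminus A1_uminus A2_uminus A4'_uminus A5_uminus
        top.not_eq_extremum)
  interpret generator_pinv "\<lambda>x. - f x" bot a top "\<lambda>v. pinv f (- v)"
    using h(3,4) by (rule generator_pinv_antimono) unfold_locales
  show "\<exists>N. total_op (null_dec f a) N \<and> nullnorm N"
    using null_dec_eq[OF nonneg] two_uninorm_imp_nullnorm[OF two_uninorm_op]
    unfolding total_op_def by auto
next
  assume h: "a = top" "inj f" "mono f" "f e1 = 0" "A1 f a" "A2 f a" "A3 f e1 a"
  \<comment> \<open>From \<open>a = top\<close> and \<open>a \<le> e2\<close> the upper neutral
    element is \<open>top\<close> as well.\<close>
  then interpret generator f e1 top top by (intro generator_top) simp_all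
  interpret generator_pinv f e1 top top "pinv f"
    by (rule generator_pinv_mono) unfold_locales
  show "\<exists>U. total_op (uni_inc f) U \<and> uninorm U \<and>
      (e1 = top \<longrightarrow> t_norm U) \<and> (e1 = bot \<longrightarrow> t_conorm U)"
    using uni_inc_eq two_uninorm_imp_uninorm[OF two_uninorm_op]
    unfolding total_op_def by blast
next
  assume h: "a = top" "inj f" "antimono f" "f e1 = 0" "D1 f a" "D2 f a" "D3 f e1 a"
  then interpret generator "\<lambda>x. - f x" e1 top top
    by (intro generator_top) (auto simp: inj_uminus mono_uminus A1_uminus A2_uminus A3_uminus)
  interpret generator_pinv "\<lambda>x. - f x" e1 top top "\<lambda>v. pinv f (- v)"
    using h(2,3) by (rule generator_pinv_antimono) unfold_locales
  show "\<exists>U. total_op (uni_dec f) U \<and> uninorm U"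
    using uni_dec_eq two_uninorm_imp_uninorm[OF two_uninorm_op]
    unfolding total_op_def by auto
qed

end
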